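(* Let $\mathfrak g=\mathfrak g_{3,3}$ be the three-dimensional real Lie algebra with basis $e_1,e_2,e_3$ and nonzero brackets $[e_1,e_3]=e_1$, $[e_2,e_3]=e_2$, and let $(\mathfrak g,\nabla)$ be a flat Lie algebra. Then $(\mathfrak g,\nabla)$ is isomorphic to exactly one of the following flat Lie algebras (only nonzero products $e_ie_j=\nabla_{e_i}e_j$ are listed): $\mathfrak h_{0,1}$: $e_1e_3=\lambda e_1,\ e_2e_3=\lambda e_2,\ e_3e_1=(\lambda-1)e_1,\ e_3e_2=(\lambda-1)e_2,\ e_3e_3=\lambda e_3$; $\lambda\in\mathbb R$. $\mathfrak h_{0,2}$: $e_1e_3=e_1,\ e_2e_3=e_2,\ e_3e_3=e_2+e_3$. $\mathfrak h_{0,3}$: $e_1e_3=\lambda e_1,\ e_3e_1=(\lambda-1)e_1,\ e_3e_2=-e_2,\ e_3e_3=\lambda e_3$; $\lambda\in\mathbb R\setminus\{0\}$. $\mathfrak h_{0,4}$: $e_1e_3=-e_1,\ e_3e_1=-2e_1,\ e_3e_2=-e_2,\ e_3e_3=e_2-e_3$. $\mathfrak h_{0,5}$: $e_1e_3=e_1,\ e_3e_2=-e_2,\ e_3e_3=e_1+e_3$. $\mathfrak h_{0,6}$: $e_2e_3=e_1,\ e_3e_1=-e_1,\ e_3e_2=e_1-e_2$. $\mathfrak h_{0,7}$: $e_3e_1=-e_1,\ e_3e_2=-e_2,\ e_3e_3=\lambda e_3$; $\lambda\in\mathbb R\setminus\{0\}$. $\mathfrak h_{0,8}$: $e_3e_1=-e_1,\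 e_3e_2=-e_2,\ e_3e_3=e_1-e_3$. $\mathfrak h_{0,9}$: $e_2e_2=\varepsilon e_3,\ e_3e_1=-e_1,\ e_3e_2=-e_2,\ e_3e_3=-2e_3$; $\varepsilon=\pm1$. $\mathfrak h_{0,10}$: $e_1e_2=e_3,\ e_2e_1=e_3,\ e_3e_1=-e_1,\ e_3e_2=-e_2,\ e_3e_3=-2e_3$. $\mathfrak h_{0,11}$: $e_1e_1=\varepsilon_1e_3,\ e_2e_2=\varepsilon_2e_3,\ e_3e_1=-e_1,\ e_3e_2=-e_2,\ e_3e_3=-2e_3$; $\varepsilon_1,\varepsilon_2=\pm1$. $\mathfrak h_{2,1}$: $e_1e_3=-e_1,\ e_2e_2=e_1,\ e_3e_1=-2e_1,\ e_3e_2=-e_2,\ e_3e_3=-e_3$. $\mathfrak h_{2,2}$: $e_2e_2=e_1,\ e_2e_3=e_2,\ e_3e_1=-e_1,\ e_3e_3=e_3$.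
   Context: A connection on a real Lie algebra $\mathfrak g$ is a bilinear map $\nabla:\mathfrak g\times\mathfrak g\to\mathfrak g$, $(X,Y)\mapsto\nabla_XY$. It is torsion-free if $\nabla_XY-\nabla_YX=[X,Y]$ for all $X,Y$, and flat if $\nabla_X\nabla_YZ-\nabla_Y\nabla_XZ-\nabla_{[X,Y]}Z=0$ for all $X,Y,Z$. A flat Lie algebra is a pair $(\mathfrak g,\nabla)$ with $\nabla$ a flat, torsion-free connection on $\mathfrak g$. Two flat torsion-free connections $\nabla^1,\nabla^2$ on $\mathfrak g$ are isomorphic if there is a Lie algebra automorphism $\Psi$ of $\mathfrak g$ with $\nabla^2_X=\Psi\circ\nabla^1_{\Psi^{-1}(X)}\circ\Psi^{-1}$ for all $X\in\mathfrak g$. Each admissible choice of the parameters gives a flat Lie algebra of the list.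
   Formalization: "Exactly one" fails as printed: h_{0,10}, h_{0,11} with (ε1,ε2)=(1,-1) and h_{0,11} with (-1,1) are isomorphic to each other. The formal theorem proves uniqueness of entry and parameters except that these three are identified as one class. *)

theory Defs
  imports "HOL-Analysis.Analysis"
begin

definition lie_bracket :: "('a::real_vector \<Rightarrow> 'a \<Rightarrow> 'a) \<Rightarrow> bool" where
  "lie_bracket br \<longleftrightarrow> bilinear br \<and> (\<forall>X. br X X = 0) \<and>
     (\<forall>X Y Z. br X (br Y Z) + br Y (br Z X) + br Z (br X Y) = 0)"

definition torsion_free ::
  "('a::real_vector \<Rightarrow> 'a \<Rightarrow> 'a) \<Rightarrow> ('a \<Rightarrow> 'a \<Rightarrow> 'a) \<Rightarrow> bool" where
  "torsion_free br nabla \<longleftrightarrow> (\<forall>X Y. nabla X Y - nabla Y X = br X Y)"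

definition flat ::
  "('a::real_vector \<Rightarrow> 'a \<Rightarrow> 'a) \<Rightarrow> ('a \<Rightarrow> 'a \<Rightarrow> 'a) \<Rightarrow> bool" where
  "flat br nabla \<longleftrightarrow>
     (\<forall>X Y Z. nabla X (nabla Y Z) - nabla Y (nabla X Z) - nabla (br X Y) Z = 0)"

definition flat_lie_algebra ::
  "('a::real_vector \<Rightarrow> 'a \<Rightarrow> 'a) \<Rightarrow> ('a \<Rightarrow> 'a \<Rightarrow> 'a) \<Rightarrow> bool" where
  "flat_lie_algebra br nabla \<longleftrightarrow>
     lie_bracket br \<and> bilinear nabla \<and> torsion_free br nabla \<and> flat br nabla"

definition lie_automorphism ::
  "('a::real_vector \<Rightarrow> 'a \<Rightarrow> 'a) \<Rightarrow> ('a \<Rightarrow> 'a) \<Rightarrow> bool" where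
  "lie_automorphism br \<Psi> \<longleftrightarrow>
     linear \<Psi> \<and> bij \<Psi> \<and> (\<forall>X Y. \<Psi> (br X Y) = br (\<Psi> X) (\<Psi> Y))"

definition connections_isomorphic ::
  "('a::real_vector \<Rightarrow> 'a \<Rightarrow> 'a) \<Rightarrow> ('a \<Rightarrow> 'a \<Rightarrow> 'a) \<Rightarrow> ('a \<Rightarrow> 'a \<Rightarrow> 'a) \<Rightarrow> bool" where
  "connections_isomorphic br nabla1 nabla2 \<longleftrightarrow>
     (\<exists>\<Psi>. lie_automorphism br \<Psi> \<and> (\<forall>X. nabla2 X = \<Psi> \<circ> nabla1 (inv \<Psi> X) \<circ> inv \<Psi>))"

abbreviation e1 :: "real^3" where "e1 \<equiv> axis 1 1"
abbreviation e2 :: "real^3" where "e2 \<equiv> axis 2 1"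
abbreviation e3 :: "real^3" where "e3 \<equiv> axis 3 1"

text \<open>The bilinear map sending the \<open>i\<close>-th and \<open>j\<close>-th basis vectors to row \<open>i\<close>, column \<open>j\<close>
  of the table.\<close>

definition of_table ::
  "real^3 \<Rightarrow> real^3 \<Rightarrow> real^3 \<Rightarrow> real^3 \<Rightarrow> real^3 \<Rightarrow> real^3 \<Rightarrow> real^3 \<Rightarrow> real^3 \<Rightarrow> real^3
    \<Rightarrow> real^3 \<Rightarrow> real^3 \<Rightarrow> real^3" where
  "of_table c11 c12 c13 c21 c22 c23 c31 c32 c33 x y =
     (x$1 * y$1) *\<^sub>R c11 + (x$1 * y$2) *\<^sub>R c12 + (x$1 * y$3) *\<^sub>R c13 +
     (x$2 * y$1) *\<^sub>R c21 + (x$2 * y$2) *\<^sub>R c22 + (x$2 * y$3) *\<^sub>R c23 +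
     (x$3 * y$1) *\<^sub>R c31 + (x$3 * y$2) *\<^sub>R c32 + (x$3 * y$3) *\<^sub>R c33"

definition g33 :: "real^3 \<Rightarrow> real^3 \<Rightarrow> real^3" where
  "g33 = of_table
      0     0    e1
      0     0    e2
    (-e1) (-e2)  0"

datatype entry =
    H0_1 real | H0_2 | H0_3 real | H0_4 | H0_5 | H0_6 | H0_7 real | H0_8
  | H0_9 real | H0_10 | H0_11 real real | H2_1 | H2_2

fun admissible :: "entry \<Rightarrow> bool" where
  "admissible (H0_3 lam) \<longleftrightarrow> lam \<noteq> 0"
| "admissible (H0_7 lam) \<longleftrightarrow> lam \<noteq> 0"
| "admissible (H0_9 \<epsilon>) \<longleftrightarrow> \<epsilon> \<in> {1, -1}"
| "admissible (H0_11 \<epsilon>\<^sub>1 \<epsilon>\<^sub>2) \<longleftrightarrow> \<epsilon>\<^sub>1 \<in> {1, -1} \<and> \<epsilon>\<^sub>2 \<in> {1, -1}"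
| "admissible _ \<longleftrightarrow> True"

fun connection_of :: "entry \<Rightarrow> real^3 \<Rightarrow> real^3 \<Rightarrow> real^3" where
  "connection_of (H0_1 lam) = of_table
      0                   0                   (lam *\<^sub>R e1)
      0                   0                   (lam *\<^sub>R e2)
      ((lam - 1) *\<^sub>R e1)   ((lam - 1) *\<^sub>R e2)   (lam *\<^sub>R e3)"
| "connection_of H0_2 = of_table
      0   0   e1
      0   0   e2
      0   0   (e2 + e3)"
| "connection_of (H0_3 lam) = of_table
      0                   0       (lam *\<^sub>R e1)
      0                   0       0
      ((lam - 1) *\<^sub>R e1)   (-e2)   (lam *\<^sub>R e3)"
| "connection_of H0_4 = of_table
      0               0       (-e1)
      0               0       0
      (-(2 *\<^sub>R e1))   (-e2)   (e2 - e3)"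
| "connection_of H0_5 = of_table
      0   0       e1
      0   0       0
      0   (-e2)   (e1 + e3)"
| "connection_of H0_6 = of_table
      0       0           0
      0       0           e1
      (-e1)   (e1 - e2)   0"
| "connection_of (H0_7 lam) = of_table
      0       0       0
      0       0       0
      (-e1)   (-e2)   (lam *\<^sub>R e3)"
| "connection_of H0_8 = of_table
      0       0       0
      0       0       0
      (-e1)   (-e2)   (e1 - e3)"
| "connection_of (H0_9 \<epsilon>) = of_table
      0       0            0
      0       (\<epsilon> *\<^sub>R e3)   0
      (-e1)   (-e2)        (-(2 *\<^sub>R e3))"
| "connection_of H0_10 = of_table
      0       e3      0
      e3      0       0
      (-e1)   (-e2)   (-(2 *\<^sub>R e3))"
| "connection_of (H0_11 \<epsilon>\<^sub>1 \<epsilon>\<^sub>2) = of_table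
      (\<epsilon>\<^sub>1 *\<^sub>R e3)   0             0
      0             (\<epsilon>\<^sub>2 *\<^sub>R e3)   0
      (-e1)         (-e2)         (-(2 *\<^sub>R e3))"
| "connection_of H2_1 = of_table
      0               0       (-e1)
      0               e1      0
      (-(2 *\<^sub>R e1))   (-e2)   (-e3)"
| "connection_of H2_2 = of_table
      0       0    0
      0       e1   e2
      (-e1)   0    e3"

text \<open>As a plane symmetric bilinear form, the product of \<open>H0_10\<close> is the hyperbolic form
  \<open>x\<^sub>1 y\<^sub>2 + x\<^sub>2 y\<^sub>1\<close>, which is equivalent over the reals to each indefinite diagonal form. So these
  three entries are one isomorphism class, listed three times (\<open>H0_10_isomorphic_H0_11\<close> below), and
  uniqueness can only hold up to this coincidence.\<close>

definition same_class :: "entry \<Rightarrow> entry \<Rightarrow> bool" where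
  "same_class p q \<longleftrightarrow> p = q \<or> {p, q} \<subseteq> {H0_10, H0_11 1 (-1), H0_11 (-1) 1}"

lemma bilinear_of_table:
  "bilinear (of_table c11 c12 c13 c21 c22 c23 c31 c32 c33)"
  unfolding bilinear_def
  by (auto intro!: linearI simp: of_table_def algebra_simps)

lemmas table_eval = vec_eq_iff forall_3 of_table_def g33_def axis_def

lemma lie_bracket_g33: "lie_bracket g33"
  unfolding lie_bracket_def
  using bilinear_of_table by (auto simp: table_eval algebra_simps)

lemma flat_lie_algebra_connection_of:
  assumes "admissible p"
  shows "flat_lie_algebra g33 (connection_of p)"
  using assms lie_bracket_g33
  by (cases p)
     (auto simp: flat_lie_algebra_def bilinear_of_table torsion_free_def flat_def
                 table_eval algebra_simps)

lemma connections_isomorphicI: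
  assumes "linear \<Psi>" "\<And>X. \<Phi> (\<Psi> X) = X" "\<And>X. \<Psi> (\<Phi> X) = X"
    and "\<And>X Y. \<Psi> (br X Y) = br (\<Psi> X) (\<Psi> Y)"
    and "\<And>X Y. \<Psi> (nabla1 X Y) = nabla2 (\<Psi> X) (\<Psi> Y)"
  shows "connections_isomorphic br nabla1 nabla2"
proof -
  have bij: "bij \<Psi>"
    using assms(2,3) by (intro o_bij[of \<Phi>]) auto
  have inv: "inv \<Psi> = \<Phi>"
    using assms(2,3) by (intro inv_equality) auto
  show ?thesis
    unfolding connections_isomorphic_def lie_automorphism_def
    using assms bij by (intro exI[of _ \<Psi>]) (auto simp: inv fun_eq_iff)
qed

lemma H0_10_isomorphic_H0_11:
  "connections_isomorphic g33 (connection_of H0_10) (connection_of (H0_11 1 (-1)))"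
  "connections_isomorphic g33 (connection_of H0_10) (connection_of (H0_11 (-1) 1))"
proof -
  show "connections_isomorphic g33 (connection_of H0_10) (connection_of (H0_11 1 (-1)))"
    by (rule connections_isomorphicI[of
          "\<lambda>x. vector [x$1 / 2 + x$2, x$1 / 2 - x$2, x$3]"
          "\<lambda>x. vector [x$1 + x$2, (x$1 - x$2) / 2, x$3]"])
       (auto intro!: linearI simp: table_eval field_simps)
  show "connections_isomorphic g33 (connection_of H0_10) (connection_of (H0_11 (-1) 1))"
    by (rule connections_isomorphicI[of
          "\<lambda>x. vector [x$1 / 2 - x$2, x$1 / 2 + x$2, x$3]"
          "\<lambda>x. vector [x$1 + x$2, (x$2 - x$1) / 2, x$3]"])
       (auto intro!: linearI simp: table_eval field_simps)
qed

end

theory Submission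
  imports Defs
begin

text \<open>
  Let \<open>V\<close> be the plane spanned by \<open>e1\<close> and \<open>e2\<close>, that is, the vectors with third coordinate \<open>0\<close>.
  The automorphisms of \<open>g33\<close> are the linear bijections preserving the third coordinate, so passing to
  an isomorphic connection amounts to choosing a frame \<open>f1, f2 \<in> V\<close>, \<open>f3 \<in> e3 + V\<close>.

  Existence. Since \<open>[v, e3] = v\<close> for \<open>v \<in> V\<close>, left multiplication by \<open>v\<close> is a commutator, hence
  traceless. If some square \<open>v v\<close> leaves \<open>V\<close>, take \<open>f2\<close> a multiple of \<open>v\<close> with
  \<open>f2 f2 = \<plusminus> f3\<close> and \<open>f1\<close> orthogonal to \<open>f2\<close>; flatness then leaves only \<open>H0_9\<close> and \<open>H0_11\<close>.
  Otherwise \<open>V V \<subseteq> V\<close>, and the trace condition forces \<open>V e3 \<subseteq> V\<close>. If \<open>v v \<noteq> 0\<close> for some \<open>v \<in> V\<close>,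
  then \<open>v v\<close> and \<open>v\<close> form a basis of \<open>V\<close>, which leads to \<open>H2_1\<close> and \<open>H2_2\<close>. If \<open>V V = 0\<close>, then right
  multiplication \<open>D\<close> by \<open>e3\<close> satisfies \<open>D\<^sup>2 = m D\<close> on \<open>V\<close>, where \<open>m\<close> is the third coordinate of
  \<open>e3 e3\<close>; the Jordan type of \<open>D\<close> and a translation of \<open>e3\<close> along \<open>V\<close> give the remaining entries.

  Uniqueness. The following are isomorphism invariants and separate the classes: the set of third
  coordinates of \<open>x x\<close> for \<open>x \<in> e3 + V\<close>, whether some such \<open>x\<close> has \<open>x x\<close> proportional to \<open>x\<close>, whether
  a nonzero element of \<open>V\<close>, or all of \<open>V\<close>, multiplies to zero from the left, and whether \<open>V V = 0\<close>.
\<close>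

subsection \<open>Isomorphisms of connections\<close>

lemma g33_eq: "g33 X Y = Y$3 *\<^sub>R X - X$3 *\<^sub>R Y"
  by (auto simp: table_eval algebra_simps)

lemma vec3_eqI: "x = y" if "x$1 = y$1" "x$2 = y$2" "x$3 = y$3" for x y :: "'a^3"
  using that by (simp add: vec_eq_iff forall_3)

lemma connections_isomorphicE:
  assumes "connections_isomorphic br nabla1 nabla2"
  obtains \<Psi> where "lie_automorphism br \<Psi>"
    "\<And>X Y. \<Psi> (nabla1 X Y) = nabla2 (\<Psi> X) (\<Psi> Y)"
proof -
  obtain \<Psi> where \<Psi>: "lie_automorphism br \<Psi>"
      and eq: "\<And>X. nabla2 X = \<Psi> \<circ> nabla1 (inv \<Psi> X) \<circ> inv \<Psi>"
    using assms unfolding connections_isomorphic_def by auto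
  have "inj \<Psi>"
    using \<Psi> by (simp add: lie_automorphism_def bij_is_inj)
  then show thesis
    using that \<Psi> eq by simp
qed

lemma lie_automorphism_inv:
  assumes "lie_automorphism br \<Psi>"
  shows "lie_automorphism br (inv \<Psi>)"
proof -
  have *: "linear \<Psi>" "bij \<Psi>" "\<And>X Y. \<Psi> (br X Y) = br (\<Psi> X) (\<Psi> Y)"
    using assms by (auto simp: lie_automorphism_def)
  have inv: "\<And>x. inv \<Psi> (\<Psi> x) = x" "\<And>x. \<Psi> (inv \<Psi> x) = x"
    using *(2) by (simp_all add: bij_is_inj bij_is_surj surj_f_inv_f)
  have "linear (inv \<Psi>)"
  proof (rule linearI)
    show "inv \<Psi> (x + y) = inv \<Psi> x + inv \<Psi> y" for x y
      using inv(1)[of "inv \<Psi> x + inv \<Psi> y"] by (simp add: linear_add[OF *(1)] inv(2))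
    show "inv \<Psi> (c *\<^sub>R x) = c *\<^sub>R inv \<Psi> x" for c x
      using inv(1)[of "c *\<^sub>R inv \<Psi> x"] by (simp add: linear_scale[OF *(1)] inv(2))
  qed
  moreover have "inv \<Psi> (br X Y) = br (inv \<Psi> X) (inv \<Psi> Y)" for X Y
    by (metis *(3) inv)
  ultimately show ?thesis
    using *(2) by (simp add: lie_automorphism_def bij_imp_bij_inv)
qed

lemma connections_isomorphic_sym:
  assumes "connections_isomorphic br nabla1 nabla2"
  shows "connections_isomorphic br nabla2 nabla1"
proof -
  obtain \<Psi> where \<Psi>: "lie_automorphism br \<Psi>"
      and hom: "\<And>X Y. \<Psi> (nabla1 X Y) = nabla2 (\<Psi> X) (\<Psi> Y)"
    using assms by (elim connections_isomorphicE) blast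
  have inv: "\<And>x. inv \<Psi> (\<Psi> x) = x" "\<And>x. \<Psi> (inv \<Psi> x) = x"
    using \<Psi> by (simp_all add: lie_automorphism_def bij_is_inj bij_is_surj surj_f_inv_f)
  have "inv \<Psi> (nabla2 X Y) = nabla1 (inv \<Psi> X) (inv \<Psi> Y)" for X Y
    by (metis hom inv)
  then show ?thesis
    using lie_automorphism_inv[OF \<Psi>] inv
    by (intro connections_isomorphicI[of "inv \<Psi>" \<Psi>]) (auto simp: lie_automorphism_def)
qed

lemma connections_isomorphic_trans:
  assumes "connections_isomorphic br nabla1 nabla2" "connections_isomorphic br nabla2 nabla3"
  shows "connections_isomorphic br nabla1 nabla3"
proof -
  obtain \<Psi> where \<Psi>: "lie_automorphism br \<Psi>"
      and hom: "\<And>X Y. \<Psi> (nabla1 X Y) = nabla2 (\<Psi> X) (\<Psi> Y)"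
    using assms(1) by (elim connections_isomorphicE) blast
  obtain \<Phi> where \<Phi>: "lie_automorphism br \<Phi>"
      and hom': "\<And>X Y. \<Phi> (nabla2 X Y) = nabla3 (\<Phi> X) (\<Phi> Y)"
    using assms(2) by (elim connections_isomorphicE) blast
  have inv: "\<And>x. inv \<Psi> (\<Psi> x) = x" "\<And>x. \<Psi> (inv \<Psi> x) = x"
      "\<And>x. inv \<Phi> (\<Phi> x) = x" "\<And>x. \<Phi> (inv \<Phi> x) = x"
    using \<Psi> \<Phi> by (simp_all add: lie_automorphism_def bij_is_inj bij_is_surj surj_f_inv_f)
  show ?thesis
  proof (rule connections_isomorphicI[of "\<Phi> \<circ> \<Psi>" "inv \<Psi> \<circ> inv \<Phi>"])
    show "linear (\<Phi> \<circ> \<Psi>)"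
      using \<Psi> \<Phi> by (simp add: lie_automorphism_def linear_compose)
    show "(\<Phi> \<circ> \<Psi>) (br X Y) = br ((\<Phi> \<circ> \<Psi>) X) ((\<Phi> \<circ> \<Psi>) Y)" for X Y
      using \<Psi> \<Phi> by (simp add: lie_automorphism_def)
  qed (simp_all add: inv hom hom')
qed

lemma connections_isomorphic_refl: "connections_isomorphic br nabla nabla"
  by (rule connections_isomorphicI[of "\<lambda>x. x" "\<lambda>x. x"]) (auto simp: linear_iff)

text \<open>By \<open>g33_eq\<close>, if the third coordinates of \<open>X\<close> and its image
  differed, compatibility with brackets would make every value of \<open>\<Psi>\<close> a multiple
  of \<open>\<Psi> X\<close>. A surjective map onto a three-dimensional space cannot have this
  property.\<close>

lemma lie_automorphism_g33_nth_3:
  assumes "lie_automorphism g33 \<Psi>"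
  shows "\<Psi> X $ 3 = X $ 3"
proof (rule ccontr)
  assume ne: "\<Psi> X $ 3 \<noteq> X $ 3"
  have lin: "linear \<Psi>" and surj: "surj \<Psi>" and br: "\<And>X Y. \<Psi> (g33 X Y) = g33 (\<Psi> X) (\<Psi> Y)"
    using assms by (auto simp: lie_automorphism_def bij_is_surj)
  have "\<exists>c. Y = c *\<^sub>R \<Psi> X" for Y
  proof -
    obtain Z where Z: "Y = \<Psi> Z"
      using surj by auto
    have "(X$3 - \<Psi> X $ 3) *\<^sub>R \<Psi> Z = (Z$3 - \<Psi> Z $ 3) *\<^sub>R \<Psi> X"
      using br[of Z X] by (simp add: g33_eq linear_diff[OF lin] linear_scale[OF lin] algebra_simps)
    moreover have "\<Psi> Z = inverse (X$3 - \<Psi> X $ 3) *\<^sub>R (X$3 - \<Psi> X $ 3) *\<^sub>R \<Psi> Z"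
      using ne by simp
    ultimately have "\<Psi> Z = (inverse (X$3 - \<Psi> X $ 3) * (Z$3 - \<Psi> Z $ 3)) *\<^sub>R \<Psi> X"
      by simp
    then show ?thesis
      using Z by blast
  qed
  then obtain c d where cd: "e1 = c *\<^sub>R \<Psi> X" "e2 = d *\<^sub>R \<Psi> X"
    by metis
  \<comment> \<open>These three equations already clash: the first gives a nonzero \<open>c\<close>,
    so the second kills \<open>\<Psi> X $ 2\<close>, which the third forbids.\<close>
  have "e1 $ 1 = c * \<Psi> X $ 1" "e1 $ 2 = c * \<Psi> X $ 2" "e2 $ 2 = d * \<Psi> X $ 2"
    by (simp_all only: cd vector_scaleR_component real_scaleR_def)
  then show False
    by (auto simp: axis_def)
qed

subsection \<open>Change of frame\<close>

text \<open>The torsion-free connection with products \<open>e1 e1 = a\<close>, \<open>e1 e2 = b\<close>, \<open>e2 e2 = c\<close>,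
  \<open>e1 e3 = p\<close>, \<open>e2 e3 = q\<close>, \<open>e3 e3 = r\<close>.\<close>

definition conn :: "real^3 \<Rightarrow> real^3 \<Rightarrow> real^3 \<Rightarrow> real^3 \<Rightarrow> real^3 \<Rightarrow> real^3 \<Rightarrow> real^3 \<Rightarrow> real^3 \<Rightarrow> real^3"
  where "conn a b c p q r = of_table a b p b c q (p - e1) (q - e2) r"

lemma conn_apply:
  "conn a b c p q r X Y =
    X$1 *\<^sub>R (Y$1 *\<^sub>R a + Y$2 *\<^sub>R b + Y$3 *\<^sub>R p) +
    X$2 *\<^sub>R (Y$1 *\<^sub>R b + Y$2 *\<^sub>R c + Y$3 *\<^sub>R q) +
    X$3 *\<^sub>R (Y$1 *\<^sub>R (p - e1) + Y$2 *\<^sub>R (q - e2) + Y$3 *\<^sub>R r)"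
  by (simp add: conn_def of_table_def algebra_simps)

text \<open>The hyperbolic entry \<open>H0_10\<close> is missing because the existence proof
  diagonalizes the quadratic form and so ends in \<open>H0_9\<close> or
  \<open>H0_11\<close>.\<close>

lemma connection_of_eq_conn:
  "connection_of (H0_1 l) = conn 0 0 0 (l *\<^sub>R e1) (l *\<^sub>R e2) (l *\<^sub>R e3)"
  "connection_of H0_2 = conn 0 0 0 e1 e2 (e2 + e3)"
  "connection_of (H0_3 l) = conn 0 0 0 (l *\<^sub>R e1) 0 (l *\<^sub>R e3)"
  "connection_of H0_4 = conn 0 0 0 (-e1) 0 (e2 - e3)"
  "connection_of H0_5 = conn 0 0 0 e1 0 (e1 + e3)"
  "connection_of H0_6 = conn 0 0 0 0 e1 0"
  "connection_of (H0_7 l) = conn 0 0 0 0 0 (l *\<^sub>R e3)"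
  "connection_of H0_8 = conn 0 0 0 0 0 (e1 - e3)"
  "connection_of (H0_9 s) = conn 0 0 (s *\<^sub>R e3) 0 0 (-(2 *\<^sub>R e3))"
  "connection_of (H0_11 s t) = conn (s *\<^sub>R e3) 0 (t *\<^sub>R e3) 0 0 (-(2 *\<^sub>R e3))"
  "connection_of H2_1 = conn 0 0 e1 (-e1) 0 (-e3)"
  "connection_of H2_2 = conn 0 0 e1 0 e2 e3"
  by (simp_all add: conn_def scaleR_2 scaleR_left_diff_distrib)

text \<open>Arguments are pulled back along the surjective \<open>\<Psi>\<close>, where the
  identities for \<open>nabla1\<close> apply. This makes the curvature equations available in every
  new frame.\<close>

lemma flat_lie_algebra_isomorphic:
  assumes "flat_lie_algebra br nabla1" "bilinear nabla2" "connections_isomorphic br nabla1 nabla2"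
  shows "flat_lie_algebra br nabla2"
proof -
  obtain \<Psi> where \<Psi>: "lie_automorphism br \<Psi>"
      and hom: "\<And>X Y. \<Psi> (nabla1 X Y) = nabla2 (\<Psi> X) (\<Psi> Y)"
    using assms(3) by (elim connections_isomorphicE) blast
  then have lin: "linear \<Psi>" and surj: "surj \<Psi>" and br: "\<And>X Y. \<Psi> (br X Y) = br (\<Psi> X) (\<Psi> Y)"
    by (auto simp: lie_automorphism_def bij_is_surj)
  have "torsion_free br nabla2"
    unfolding torsion_free_def
  proof (intro allI)
    fix X Y
    obtain X' Y' where "X = \<Psi> X'" "Y = \<Psi> Y'"
      using surj by (metis surj_def)
    moreover have "\<Psi> (nabla1 X' Y' - nabla1 Y' X') = \<Psi> (br X' Y')"
      using assms(1) by (simp add: flat_lie_algebra_def torsion_free_def)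
    ultimately show "nabla2 X Y - nabla2 Y X = br X Y"
      by (simp add: linear_diff[OF lin] hom br)
  qed
  moreover have "flat br nabla2"
    unfolding flat_def
  proof (intro allI)
    fix X Y Z
    obtain X' Y' Z' where "X = \<Psi> X'" "Y = \<Psi> Y'" "Z = \<Psi> Z'"
      using surj by (metis surj_def)
    moreover have "\<Psi> (nabla1 X' (nabla1 Y' Z') - nabla1 Y' (nabla1 X' Z') - nabla1 (br X' Y') Z') = \<Psi> 0"
      using assms(1) by (simp add: flat_lie_algebra_def flat_def)
    ultimately show "nabla2 X (nabla2 Y Z) - nabla2 Y (nabla2 X Z) - nabla2 (br X Y) Z = 0"
      by (simp add: linear_diff[OF lin] linear_0[OF lin] hom br)
  qed
  ultimately show ?thesis
    using assms(1,2) by (simp add: flat_lie_algebra_def)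
qed

text \<open>Precisely the condition for the linear map \<open>comb f1 f2 f3\<close> to be bijective
  and to preserve third coordinates.\<close>

definition frame :: "real^3 \<Rightarrow> real^3 \<Rightarrow> real^3 \<Rightarrow> bool" where
  "frame f1 f2 f3 \<longleftrightarrow> f1$3 = 0 \<and> f2$3 = 0 \<and> f3$3 = 1 \<and> f1$1 * f2$2 - f1$2 * f2$1 \<noteq> 0"

definition comb :: "real^3 \<Rightarrow> real^3 \<Rightarrow> real^3 \<Rightarrow> real^3 \<Rightarrow> real^3" where
  "comb f1 f2 f3 x = x$1 *\<^sub>R f1 + x$2 *\<^sub>R f2 + x$3 *\<^sub>R f3"

text \<open>Cramer's rule for the inverse of \<open>comb f1 f2 f3\<close>.\<close>

definition coords :: "real^3 \<Rightarrow> real^3 \<Rightarrow> real^3 \<Rightarrow> real^3 \<Rightarrow> real^3" where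
  "coords f1 f2 f3 z =
    vector [((z$1 - z$3 * f3$1) * f2$2 - (z$2 - z$3 * f3$2) * f2$1) / (f1$1 * f2$2 - f1$2 * f2$1),
            (f1$1 * (z$2 - z$3 * f3$2) - f1$2 * (z$1 - z$3 * f3$1)) / (f1$1 * f2$2 - f1$2 * f2$1),
            z$3]"

lemma coords_nth_3: "coords f1 f2 f3 z $ 3 = z $ 3"
  by (simp add: coords_def)

lemma coords_comb:
  assumes "frame f1 f2 f3"
  shows "coords f1 f2 f3 (comb f1 f2 f3 x) = x"
proof (rule vec3_eqI)
  have d: "f1$1 * f2$2 - f1$2 * f2$1 \<noteq> 0" and f: "f1$3 = 0" "f2$3 = 0" "f3$3 = 1"
    using assms by (auto simp: frame_def)
  show "coords f1 f2 f3 (comb f1 f2 f3 x) $ 1 = x $ 1"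
    using d by (simp add: coords_def comb_def f divide_eq_eq) (simp add: algebra_simps)
  show "coords f1 f2 f3 (comb f1 f2 f3 x) $ 2 = x $ 2"
    using d by (simp add: coords_def comb_def f divide_eq_eq) (simp add: algebra_simps)
  show "coords f1 f2 f3 (comb f1 f2 f3 x) $ 3 = x $ 3"
    by (simp add: coords_def comb_def f)
qed

lemma comb_coords:
  assumes "frame f1 f2 f3"
  shows "comb f1 f2 f3 (coords f1 f2 f3 z) = z"
proof -
  have d: "f1$1 * f2$2 - f1$2 * f2$1 \<noteq> 0" and f: "f1$3 = 0" "f2$3 = 0" "f3$3 = 1"
    using assms by (auto simp: frame_def)
  \<comment> \<open>Brings the two Cramer quotients over the common determinant, so that only a
    polynomial identity remains.\<close>
  have "x / (f1$1 * f2$2 - f1$2 * f2$1) * u + y / (f1$1 * f2$2 - f1$2 * f2$1) * v = w"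
    if "x * u + y * v = w * (f1$1 * f2$2 - f1$2 * f2$1)" for x y u v w
    using d that by (simp add: add_divide_distrib[symmetric] divide_eq_eq)
  note * = this
  show ?thesis
  proof (rule vec3_eqI)
    have "comb f1 f2 f3 (coords f1 f2 f3 z) $ 1 =
        coords f1 f2 f3 z $ 1 * f1$1 + coords f1 f2 f3 z $ 2 * f2$1 + z$3 * f3$1"
      by (simp add: comb_def coords_nth_3)
    also have "coords f1 f2 f3 z $ 1 * f1$1 + coords f1 f2 f3 z $ 2 * f2$1 = z$1 - z$3 * f3$1"
      unfolding coords_def vector_3 by (rule *) (simp add: algebra_simps)
    finally show "comb f1 f2 f3 (coords f1 f2 f3 z) $ 1 = z $ 1"
      by simp
    have "comb f1 f2 f3 (coords f1 f2 f3 z) $ 2 =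
        coords f1 f2 f3 z $ 1 * f1$2 + coords f1 f2 f3 z $ 2 * f2$2 + z$3 * f3$2"
      by (simp add: comb_def coords_nth_3)
    also have "coords f1 f2 f3 z $ 1 * f1$2 + coords f1 f2 f3 z $ 2 * f2$2 = z$2 - z$3 * f3$2"
      unfolding coords_def vector_3 by (rule *) (simp add: algebra_simps)
    finally show "comb f1 f2 f3 (coords f1 f2 f3 z) $ 2 = z $ 2"
      by simp
  qed (simp add: comb_def coords_def f)
qed

lemma linear_comb: "linear (comb f1 f2 f3)"
  by (rule linearI) (simp_all add: comb_def algebra_simps)

text \<open>Six products suffice, since torsion-freeness determines the products in the opposite
  order. The map \<open>comb f1 f2 f3\<close> is an isomorphism from the coordinate connection to
  \<open>nabla\<close>, and symmetry reverses it.\<close>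

lemma frame_isomorphic_conn:
  assumes nabla: "flat_lie_algebra g33 nabla" and f: "frame f1 f2 f3"
  defines "C \<equiv> coords f1 f2 f3"
  shows "connections_isomorphic g33 nabla (conn (C (nabla f1 f1)) (C (nabla f1 f2)) (C (nabla f2 f2))
    (C (nabla f1 f3)) (C (nabla f2 f3)) (C (nabla f3 f3)))" (is "connections_isomorphic _ _ ?conn")
proof -
  have bil: "bilinear nabla"
    using nabla by (simp add: flat_lie_algebra_def)
  have tf: "nabla X Y = nabla Y X + g33 X Y" for X Y
    using nabla by (simp add: flat_lie_algebra_def torsion_free_def eq_diff_eq add.commute flip: diff_eq_eq)
  have f3: "f1$3 = 0" "f2$3 = 0" "f3$3 = 1"
    using f by (auto simp: frame_def)
  let ?\<Phi> = "comb f1 f2 f3"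
  have \<Phi>C: "?\<Phi> (C z) = z" and C\<Phi>: "C (?\<Phi> z) = z" for z
    unfolding C_def using f by (simp_all add: coords_comb comb_coords)
  note lin = linear_add[OF linear_comb] linear_diff[OF linear_comb] linear_scale[OF linear_comb]
  have \<Phi>e: "?\<Phi> e1 = f1" "?\<Phi> e2 = f2"
    by (simp_all add: comb_def axis_def)
  have n3: "?\<Phi> x $ 3 = x $ 3" for x
    by (simp add: comb_def f3)
  have t: "nabla f2 f1 = nabla f1 f2" "nabla f3 f1 = nabla f1 f3 - f1" "nabla f3 f2 = nabla f2 f3 - f2"
    using tf[of f2 f1] tf[of f3 f1] tf[of f3 f2] by (simp_all add: g33_eq f3)
  have hom: "?\<Phi> (?conn X Y) = nabla (?\<Phi> X) (?\<Phi> Y)" for X Y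
    unfolding conn_apply
    by (simp add: lin \<Phi>C \<Phi>e)
       (simp add: comb_def bilinear_ladd[OF bil] bilinear_radd[OF bil] bilinear_lmul[OF bil]
        bilinear_rmul[OF bil] t algebra_simps)
  have "connections_isomorphic g33 ?conn nabla"
    by (rule connections_isomorphicI[of ?\<Phi> C])
       (simp_all add: linear_comb \<Phi>C C\<Phi> hom g33_eq lin n3)
  then show ?thesis
    by (rule connections_isomorphic_sym)
qed

text \<open>Allows a normal form to be verified by expanding products in the frame itself, without
  the quotients of Cramer's rule.\<close>

lemma frame_isomorphicI:
  assumes "flat_lie_algebra g33 nabla" "frame f1 f2 f3"
    and "nabla f1 f1 = comb f1 f2 f3 a" "nabla f1 f2 = comb f1 f2 f3 b" "nabla f2 f2 = comb f1 f2 f3 c"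
    and "nabla f1 f3 = comb f1 f2 f3 p" "nabla f2 f3 = comb f1 f2 f3 q" "nabla f3 f3 = comb f1 f2 f3 r"
  shows "connections_isomorphic g33 nabla (conn a b c p q r)"
  using frame_isomorphic_conn[OF assms(1,2)] by (simp add: assms(2-) coords_comb)

text \<open>The curvature at \<open>(e1, e2)\<close>, \<open>(e1, e3)\<close>, \<open>(e2, e3)\<close>, each applied to \<open>e1\<close>, \<open>e2\<close>, \<open>e3\<close>.\<close>

lemma flat_conn:
  assumes "flat_lie_algebra g33 (conn a b c p q r)"
  shows
    "b$1 * a$i + b$2 * b$i + b$3 * p$i = a$1 * b$i + a$2 * c$i + a$3 * q$i" (is ?G0)
    "c$1 * a$i + c$2 * b$i + c$3 * p$i = b$1 * b$i + b$2 * c$i + b$3 * q$i" (is ?G1)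
    "q$1 * a$i + q$2 * b$i + q$3 * p$i = p$1 * b$i + p$2 * c$i + p$3 * q$i" (is ?G2)
    "p$1 * a$i + p$2 * b$i + p$3 * p$i =
       a$1 * (p$i - e1$i) + a$2 * (q$i - e2$i) + a$3 * r$i + 2 * a$i" (is ?G3)
    "q$1 * a$i + q$2 * b$i + q$3 * p$i =
       b$1 * (p$i - e1$i) + b$2 * (q$i - e2$i) + b$3 * r$i + 2 * b$i" (is ?G4)
    "r$1 * a$i + r$2 * b$i + r$3 * p$i =
       p$1 * (p$i - e1$i) + p$2 * (q$i - e2$i) + p$3 * r$i + p$i" (is ?G5)
    "p$1 * b$i + p$2 * c$i + p$3 * q$i =
       b$1 * (p$i - e1$i) + b$2 * (q$i - e2$i) + b$3 * r$i + 2 * b$i" (is ?G6)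
    "q$1 * b$i + q$2 * c$i + q$3 * q$i =
       c$1 * (p$i - e1$i) + c$2 * (q$i - e2$i) + c$3 * r$i + 2 * c$i" (is ?G7)
    "r$1 * b$i + r$2 * c$i + r$3 * q$i =
       q$1 * (p$i - e1$i) + q$2 * (q$i - e2$i) + q$3 * r$i + q$i" (is ?G8)
proof -
  let ?n = "conn a b c p q r"
  have flat: "?n X (?n Y Z) $ i - ?n Y (?n X Z) $ i - ?n (g33 X Y) Z $ i = 0" for X Y Z i
    using assms unfolding flat_lie_algebra_def flat_def by (metis vector_minus_component zero_index)
  have g: "g33 e1 e2 = 0" "g33 e1 e3 = e1" "g33 e2 e3 = e2"
    by (simp_all add: g33_eq axis_def)
  have n: "?n 0 X = 0" "?n e1 X = X$1 *\<^sub>R a + X$2 *\<^sub>R b + X$3 *\<^sub>R p"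
    "?n e2 X = X$1 *\<^sub>R b + X$2 *\<^sub>R c + X$3 *\<^sub>R q"
    "?n e3 X = X$1 *\<^sub>R (p - e1) + X$2 *\<^sub>R (q - e2) + X$3 *\<^sub>R r" for X
    by (simp_all add: conn_apply axis_def)
  have e: "e1$1 = 1" "e1$2 = 0" "e1$3 = 0" "e2$1 = 0" "e2$2 = 1" "e2$3 = 0" "e3$1 = 0" "e3$2 = 0" "e3$3 = 1"
    by (simp_all add: axis_def)
  note eval = g n e algebra_simps
  show "?G0" using flat[of e1 e2 e1 i] by (simp add: eval)
  show "?G1" using flat[of e1 e2 e2 i] by (simp add: eval)
  show "?G2" using flat[of e1 e2 e3 i] by (simp add: eval)
  show "?G3" using flat[of e1 e3 e1 i] by (simp add: eval)
  show "?G4" using flat[of e1 e3 e2 i] by (simp add: eval)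
  show "?G5" using flat[of e1 e3 e3 i] by (simp add: eval)
  show "?G6" using flat[of e2 e3 e1 i] by (simp add: eval)
  show "?G7" using flat[of e2 e3 e2 i] by (simp add: eval)
  show "?G8" using flat[of e2 e3 e3 i] by (simp add: eval)
qed

lemma basis_nth:
  "e1$1 = 1" "e1$2 = 0" "e1$3 = 0" "e2$1 = 0" "e2$2 = 1" "e2$3 = 0" "e3$1 = 0" "e3$2 = 0" "e3$3 = 1"
  by (simp_all add: axis_def)

lemma flat_lie_algebra_conn_coords:
  assumes "flat_lie_algebra g33 nabla" "connections_isomorphic g33 nabla (conn a b c p q r)"
  shows "flat_lie_algebra g33 (conn a b c p q r)"
  using assms by (rule_tac flat_lie_algebra_isomorphic) (auto simp: conn_def bilinear_of_table)

text \<open>Left multiplication by \<open>e1\<close> and by \<open>e2\<close> has trace \<open>0\<close>: sum the diagonal entries of its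
  commutator with left multiplication by \<open>e3\<close>.\<close>

lemma trace_conn:
  assumes "flat_lie_algebra g33 (conn a b c p q r)"
  shows "a$1 + b$2 + p$3 = 0" "b$1 + c$2 + q$3 = 0"
proof -
  note E = flat_conn[OF assms]
  show "a$1 + b$2 + p$3 = 0"
    using E(4)[of 1] E(5)[of 2] E(6)[of 3] by (simp add: basis_nth algebra_simps)
  show "b$1 + c$2 + q$3 = 0"
    using E(7)[of 1] E(8)[of 2] E(9)[of 3] by (simp add: basis_nth algebra_simps)
qed

section \<open>Normal forms when a square leaves the plane\<close>

text \<open>Once \<open>e2\<close> is normalized and \<open>e1\<close> is orthogonal to it for the
  form given by the third coordinate of the product, flatness leaves \<open>a$3\<close> as the only
  free parameter.\<close>

lemma flat_conn_nonisotropic: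
  assumes flat: "flat_lie_algebra g33 (conn a b c p q r)"
    and b3: "b$3 = 0" and c: "c = s *\<^sub>R e3" and s: "s \<in> {1, -1}"
  shows "conn a b c p q r = conn (a$3 *\<^sub>R e3) 0 (s *\<^sub>R e3) 0 0 (-(2 *\<^sub>R e3))"
proof -
  note E = flat_conn[OF flat] and tr = trace_conn[OF flat]
  have c': "c$1 = 0" "c$2 = 0" "c$3 = s"
    by (simp_all add: c basis_nth)
  have s0: "s \<noteq> 0"
    using s by auto
  have q3: "q$3 = - b$1"
    using tr(2) c' by simp
  have p: "p$1 = s * (b$1 * b$1)" "p$2 = s * (b$1 * b$2)" "p$3 = b$2"
    using E(2)[of 1] E(2)[of 2] E(2)[of 3] s by (auto simp: c' b3)
  \<comment> \<open>The curvature equations for \<open>(e1, e2)\<close> on \<open>e3\<close> and for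
    \<open>(e1, e3)\<close> on \<open>e2\<close> have the same left side. Comparing right sides
    cancels everything but the coordinate of \<open>b\<close>.\<close>
  have b1: "b$1 = 0"
    using E(3)[of 1] E(5)[of 1] by (simp add: c' b3 p q3 basis_nth algebra_simps)
  have b2: "b$2 = 0"
    using E(3)[of 2] E(5)[of 2] by (auto simp: c' b3 p q3 b1 basis_nth algebra_simps)
  note z = c' b3 q3 p b1 b2 s0 basis_nth
  have r: "r$1 = 0" "r$2 = 0" and q2: "q$2 = r$3 + 2"
    using E(8)[of 1] E(8)[of 2] E(8)[of 3] s by (auto simp: z algebra_simps)
  have a: "a$1 = 0" "a$2 = 0"
    using tr(1) E(1)[of 3] by (simp_all add: z)
  have "(q$2 - r$3) * q$1 = 0" "(q$2 - r$3) * q$2 = 0"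
    using E(9)[of 1] E(9)[of 2] by (auto simp: z r algebra_simps)
  \<comment> \<open>The common factor \<open>q$2 - r$3\<close> equals 2.\<close>
  then have q: "q$1 = 0" "q$2 = 0"
    using q2 by auto
  have "a = a$3 *\<^sub>R e3" "b = 0" "p = 0" "q = 0" "r = -(2 *\<^sub>R e3)"
    using q2 by (simp_all add: vec_eq_iff forall_3 a r q z)
  then show ?thesis
    using c by metis
qed

lemma ex_square_scaling_to_sgn:
  fixes t :: real
  assumes "t \<noteq> 0"
  obtains l where "l \<noteq> 0" "l * l * t = sgn t"
proof
  have "l * l = \<bar>t\<bar>" if "l = sqrt \<bar>t\<bar>" for l
    using that by simp
  then show "inverse (sqrt \<bar>t\<bar>) * inverse (sqrt \<bar>t\<bar>) * t = sgn t"
    using assms by (simp add: inverse_mult_distrib[symmetric] sgn_if)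
qed (use assms in simp)

text \<open>Polarization: the bracket vanishes on the plane, so \<open>nabla\<close> is symmetric
  there. It is applied with \<open>L\<close> the third coordinate and with \<open>L\<close> the
  identity.\<close>

lemma ex_nonisotropic:
  assumes nabla: "flat_lie_algebra g33 nabla"
    and ne: "\<not> (\<forall>u v. u$3 = 0 \<longrightarrow> v$3 = 0 \<longrightarrow> L (nabla u v) = 0)" and L: "linear L"
  obtains v where "v$3 = 0" "L (nabla v v) \<noteq> 0"
proof -
  have bil: "bilinear nabla"
    using nabla by (simp add: flat_lie_algebra_def)
  obtain u v where uv: "u$3 = 0" "v$3 = 0" "L (nabla u v) \<noteq> 0"
    using ne by blast
  have "nabla u v - nabla v u = 0"
    using nabla uv by (simp add: flat_lie_algebra_def torsion_free_def g33_eq)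
  then have "nabla (u + v) (u + v) = nabla u u + nabla v v + 2 *\<^sub>R nabla u v"
    by (simp add: bilinear_ladd[OF bil] bilinear_radd[OF bil] scaleR_2)
  then have "L (nabla (u + v) (u + v)) = L (nabla u u) + L (nabla v v) + 2 *\<^sub>R L (nabla u v)"
    by (simp add: linear_add[OF L] linear_scale[OF L])
  then show thesis
    using that[of u] that[of v] that[of "u + v"] uv by force
qed

lemma classification_transversal:
  assumes nabla: "flat_lie_algebra g33 nabla" and v: "v$3 = 0" "nabla v v $ 3 \<noteq> 0"
  shows "\<exists>p. admissible p \<and> connections_isomorphic g33 nabla (connection_of p)"
proof -
  have bil: "bilinear nabla"
    using nabla by (simp add: flat_lie_algebra_def)
  note bil' = bilinear_ladd[OF bil] bilinear_radd[OF bil] bilinear_lmul[OF bil] bilinear_rmul[OF bil]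
  define N where "N = nabla v v $ 3"
  define s where "s = sgn N"
  have N0: "N \<noteq> 0"
    using v by (simp add: N_def)
  have s: "s \<in> {1, -1}"
    using N0 by (simp add: s_def sgn_if)
  obtain k where kN: "k * k * N = s"
    using ex_square_scaling_to_sgn[OF N0] s_def by metis
  define f2 where "f2 = k *\<^sub>R v"
  \<comment> \<open>As \<open>s * s = 1\<close>, the third coordinate of \<open>f3\<close> is 1 and
    the square of \<open>f2\<close> is \<open>s\<close> times \<open>f3\<close>.\<close>
  define f3 where "f3 = s *\<^sub>R nabla f2 f2"
  have f2: "f2$3 = 0" "nabla f2 f2 $ 3 = s"
    using kN by (simp_all add: f2_def v bil' N_def mult.assoc)
  define x y where "x = nabla f2 e1 $ 3" and "y = nabla f2 e2 $ 3"
  \<comment> \<open>Spans the kernel of the functional taking \<open>u\<close> in the plane to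
    \<open>nabla f2 u $ 3\<close>. That functional has value \<open>s\<close> at \<open>f2\<close>,
    so \<open>f1\<close> and \<open>f2\<close> are independent.\<close>
  define f1 where "f1 = (-y) *\<^sub>R e1 + x *\<^sub>R e2"
  have "f2 = f2$1 *\<^sub>R e1 + f2$2 *\<^sub>R e2"
    using f2 by (simp add: vec_eq_iff forall_3 basis_nth)
  then have "nabla f2 f2 = nabla f2 (f2$1 *\<^sub>R e1 + f2$2 *\<^sub>R e2)"
    by simp
  then have "s = f2$1 * x + f2$2 * y"
    using f2(2) by (simp add: bil' x_def y_def)
  then have "f1$1 * f2$2 - f1$2 * f2$1 = - s" "f1$3 = 0"
    by (simp_all add: f1_def basis_nth algebra_simps)
  then have fr: "frame f1 f2 f3"
    using s f2 by (auto simp: frame_def f3_def)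
  have "nabla f2 f1 $ 3 = 0"
    by (simp add: f1_def bil' x_def y_def bilinear_rsub[OF bil])
  moreover have "nabla f1 f2 - nabla f2 f1 = 0"
    using nabla fr by (simp add: flat_lie_algebra_def torsion_free_def g33_eq frame_def)
  ultimately have f12: "nabla f1 f2 $ 3 = 0"
    by simp
  have "nabla f2 f2 = comb f1 f2 f3 (s *\<^sub>R e3)"
    using s by (auto simp: comb_def f3_def basis_nth)
  then have f22: "coords f1 f2 f3 (nabla f2 f2) = s *\<^sub>R e3"
    using coords_comb[OF fr] by simp
  define t where "t = nabla f1 f1 $ 3"
  define n where "n = conn (t *\<^sub>R e3) 0 (s *\<^sub>R e3) 0 0 (-(2 *\<^sub>R e3))"
  note iso = frame_isomorphic_conn[OF nabla fr]
  note flat = flat_lie_algebra_conn_coords[OF nabla iso]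
  have iso': "connections_isomorphic g33 nabla n"
    using iso unfolding n_def t_def
    by (subst (asm) flat_conn_nonisotropic[OF flat _ f22 s]) (simp_all add: coords_nth_3 f12)
  show ?thesis
  \<comment> \<open>A degenerate form gives \<open>H0_9\<close>; otherwise rescaling
    \<open>f1\<close> turns \<open>t\<close> into its sign.\<close>
  proof (cases "t = 0")
    case True
    then show ?thesis
      using iso' s by (intro exI[of _ "H0_9 s"]) (auto simp: n_def connection_of_eq_conn simp del: connection_of.simps)
  next
    case False
    define u where "u = sgn t"
    obtain l where l: "l * l * t = u" "l \<noteq> 0"
      using ex_square_scaling_to_sgn[OF False] u_def by metis
    have u: "u \<in> {1, -1}"
      using False by (simp add: u_def sgn_if)
    have flat': "flat_lie_algebra g33 n"
      using flat_lie_algebra_isomorphic[OF nabla _ iso'] by (simp add: n_def conn_def bilinear_of_table)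
    have "connections_isomorphic g33 n (conn (u *\<^sub>R e3) 0 (s *\<^sub>R e3) 0 0 (-(2 *\<^sub>R e3)))"
    proof (rule frame_isomorphicI[OF flat', of "l *\<^sub>R e1" e2 e3])
      show "frame (l *\<^sub>R e1) e2 e3"
        using l by (simp add: frame_def basis_nth)
    qed (use l in \<open>simp_all add: n_def conn_apply comb_def basis_nth vec_eq_iff forall_3\<close>)
    then have "connections_isomorphic g33 nabla (connection_of (H0_11 u s))"
      using connections_isomorphic_trans[OF iso'] by (simp only: connection_of_eq_conn)
    then show ?thesis
      using u s by (intro exI[of _ "H0_11 u s"]) simp
  qed
qed

section \<open>Normal forms when the plane is closed under products\<close>

lemma frameI:
  assumes "f1$3 = 0" "f2$3 = 0" "f3$3 = 1" "f1 \<noteq> 0" "\<And>k. f2 \<noteq> k *\<^sub>R f1"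
  shows "frame f1 f2 f3"
proof -
  have "f1$1 * f2$2 - f1$2 * f2$1 \<noteq> 0"
  proof
    assume d: "f1$1 * f2$2 - f1$2 * f2$1 = 0"
    show False
    proof (cases "f1$1 = 0")
      case True
      then have "f1$2 \<noteq> 0"
        using assms(1,4) by (auto simp: vec_eq_iff forall_3)
      then have "f2 = (f2$2 / f1$2) *\<^sub>R f1"
        using True d assms(1,2) by (simp add: vec_eq_iff forall_3)
      then show False
        using assms(5) by blast
    next
      case False
      then have "f2 = (f2$1 / f1$1) *\<^sub>R f1"
        using d assms(1,2) by (simp add: vec_eq_iff forall_3 field_simps)
      then show False
        using assms(5) by blast
    qed
  qed
  then show ?thesis
    using assms by (simp add: frame_def)
qed

lemma frame_complement:
  assumes "v$3 = 0" "v \<noteq> 0" "f3$3 = 1"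
  obtains g where "frame g v f3"
proof
  have "v$1 * v$1 + v$2 * v$2 \<noteq> 0"
    using assms(1,2) by (auto simp: sum_squares_eq_zero_iff vec_eq_iff forall_3)
  \<comment> \<open>A quarter turn of \<open>v\<close>, for which the determinant is the squared
    length of \<open>v\<close>.\<close>
  then show "frame (vector [v$2, - v$1, 0]) v f3"
    using assms by (auto simp: frame_def)
qed

lemma frame_swap: "frame f1 f2 f3 \<Longrightarrow> frame f2 f1 f3"
  by (auto simp: frame_def algebra_simps)

text \<open>If the functional \<open>v\<close> to \<open>nabla v e3 $ 3\<close> were nonzero on the
  plane, a frame could have values 0 at \<open>f1\<close> and 1 at \<open>f2\<close>. The trace
  condition would then make the \<open>f1\<close>-component of \<open>nabla f1 f2\<close> equal to
  -2, while curvature at \<open>(f1, f2)\<close> on \<open>f2\<close> makes it equal to its own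
  square.\<close>

lemma flat_no_character:
  assumes nabla: "flat_lie_algebra g33 nabla"
    and plane: "\<And>u v. u$3 = 0 \<Longrightarrow> v$3 = 0 \<Longrightarrow> nabla u v $ 3 = 0" and v: "v$3 = 0"
  shows "nabla v e3 $ 3 = 0"
proof (rule ccontr)
  assume v0: "nabla v e3 $ 3 \<noteq> 0"
  have bil: "bilinear nabla"
    using nabla by (simp add: flat_lie_algebra_def)
  note bil' = bilinear_ladd[OF bil] bilinear_radd[OF bil] bilinear_lmul[OF bil] bilinear_rmul[OF bil]
    bilinear_lsub[OF bil]
  define f2 where "f2 = inverse (nabla v e3 $ 3) *\<^sub>R v"
  have f2: "f2$3 = 0" "nabla f2 e3 $ 3 = 1"
    using v v0 by (simp_all add: f2_def bil')
  define x y where "x = nabla e1 e3 $ 3" and "y = nabla e2 e3 $ 3"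
  define f1 where "f1 = (-y) *\<^sub>R e1 + x *\<^sub>R e2"
  have f1: "f1$3 = 0" "nabla f1 e3 $ 3 = 0"
    by (simp_all add: f1_def bil' x_def y_def) (simp add: basis_nth)
  have "f2 = f2$1 *\<^sub>R e1 + f2$2 *\<^sub>R e2"
    using f2 by (simp add: vec_eq_iff forall_3 basis_nth)
  then have "nabla f2 e3 = nabla (f2$1 *\<^sub>R e1 + f2$2 *\<^sub>R e2) e3"
    by simp
  then have "1 = f2$1 * x + f2$2 * y"
    using f2(2) by (simp add: bil' x_def y_def)
  then have fr: "frame f1 f2 e3"
    using f2 by (auto simp: frame_def f1_def basis_nth algebra_simps)
  note flat = flat_lie_algebra_conn_coords[OF nabla frame_isomorphic_conn[OF nabla fr]]
  define C where "C = coords f1 f2 e3"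
  have z: "C (nabla f1 f1) $ 3 = 0" "C (nabla f1 f2) $ 3 = 0" "C (nabla f2 f2) $ 3 = 0"
    "C (nabla f1 e3) $ 3 = 0" "C (nabla f2 e3) $ 3 = 1"
    by (simp_all add: C_def coords_nth_3 plane f1 f2)
  note E = flat_conn[OF flat, folded C_def] and tr = trace_conn[OF flat, folded C_def]
  have "C (nabla f1 f1) $ 2 = 0" "C (nabla f1 f2) $ 2 = 0" "C (nabla f2 f2) $ 2 = 1"
    using E(4)[of 3] E(5)[of 3] E(8)[of 3] by (simp_all add: z basis_nth)
  then show False
    using tr E(2)[of 1] by (simp add: z)
qed

lemma classification_nonzero_plane_product:
  assumes nabla: "flat_lie_algebra g33 nabla"
    and plane: "\<And>u v. u$3 = 0 \<Longrightarrow> v$3 = 0 \<Longrightarrow> nabla u v $ 3 = 0"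
    and v: "v$3 = 0" "nabla v v \<noteq> 0"
  shows "\<exists>p. admissible p \<and> connections_isomorphic g33 nabla (connection_of p)"
proof -
  have bil: "bilinear nabla"
    using nabla by (simp add: flat_lie_algebra_def)
  note char = flat_no_character[OF nabla plane]
  have e3: "e3$3 = 1"
    by simp
  have v0: "v \<noteq> 0"
    using v(2) bilinear_lzero[OF bil] by auto
  define f1 where "f1 = nabla v v"
  have f1: "f1$3 = 0" "f1 \<noteq> 0"
    using v by (simp_all add: f1_def plane)
  have "frame v f1 e3"
  proof (rule frameI[OF v(1) f1(1) e3 v0])
    fix k
    show "f1 \<noteq> k *\<^sub>R v"
    proof
      assume k: "f1 = k *\<^sub>R v"
      obtain g where fr: "frame g v e3"
        using frame_complement[OF v(1) v0 e3] .
      have g: "g$3 = 0"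
        using fr by (simp add: frame_def)
      note flat = flat_lie_algebra_conn_coords[OF nabla frame_isomorphic_conn[OF nabla fr]]
      define C where "C = coords g v e3"
      have "nabla v v = comb g v e3 (k *\<^sub>R e2)"
        using k by (simp add: f1_def comb_def basis_nth)
      then have "C (nabla v v) = k *\<^sub>R e2"
        by (simp add: C_def coords_comb[OF fr])
      then have c: "C (nabla v v) $ 1 = 0" "C (nabla v v) $ 2 = k" "C (nabla v v) $ 3 = 0"
        by (simp_all add: axis_def)
      have z: "C (nabla g v) $ 3 = 0" "C (nabla v e3) $ 3 = 0"
        by (simp_all add: C_def coords_nth_3 plane char g v)
      note E = flat_conn[OF flat, folded C_def] and tr = trace_conn[OF flat, folded C_def]
      \<comment> \<open>Curvature at \<open>(g, v)\<close> on \<open>v\<close> against the trace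
        condition: together they give \<open>- k * k = k * k\<close>.\<close>
      have "k * C (nabla g v) $ 1 = C (nabla g v) $ 1 * C (nabla g v) $ 1" "C (nabla g v) $ 1 = - k"
        using E(2)[of 1] tr(2) by (simp_all add: c z)
      then have "k = 0"
        by simp
      then show False
        using k f1(2) by simp
    qed
  qed
  then have fr: "frame f1 v e3"
    by (rule frame_swap)
  define C where "C = coords f1 v e3"
  define a b c p q r where abbrs: "a = C (nabla f1 f1)" "b = C (nabla f1 v)" "c = C (nabla v v)"
    "p = C (nabla f1 e3)" "q = C (nabla v e3)" "r = C (nabla e3 e3)"
  have iso: "connections_isomorphic g33 nabla (conn a b c p q r)"
    unfolding abbrs C_def by (rule frame_isomorphic_conn[OF nabla fr])
  note flat = flat_lie_algebra_conn_coords[OF nabla iso]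
  note E = flat_conn[OF flat] and tr = trace_conn[OF flat]
  have "nabla v v = comb f1 v e3 e1"
    by (simp add: f1_def comb_def basis_nth)
  then have c: "c = e1"
    by (simp add: abbrs C_def coords_comb[OF fr])
  have z: "a$3 = 0" "b$3 = 0" "p$3 = 0" "q$3 = 0"
    by (simp_all add: abbrs C_def coords_nth_3 plane char f1 v)
  have b1: "b$1 = 0" and a1: "a$1 = - b$2"
    using tr by (simp_all add: c z basis_nth)
  have a: "a$1 = b$2" "a$2 = 0"
    using E(2)[of 1] E(2)[of 2] by (simp_all add: c z b1 basis_nth)
  then have b2: "b$2 = 0"
    using a1 by linarith
  have ab: "a = 0" "b = 0"
    using a b1 b2 z by (simp_all add: vec_eq_iff forall_3)
  have p2: "p$2 = 0"
    using E(7)[of 1] by (simp add: ab c z basis_nth)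
  have pr: "r$3 * p$1 = p$1 * p$1"
    using E(6)[of 1] by (simp add: ab z p2 basis_nth algebra_simps)
  have qp: "q$2 = p$1 + 1"
    using E(8)[of 1] by (simp add: ab c z basis_nth algebra_simps)
  have r2: "r$2 = q$1 * (p$1 + q$2 - r$3)" and qr: "r$3 * q$2 = q$2 * q$2"
    using E(9)[of 1] E(9)[of 2] by (simp_all add: ab c z p2 basis_nth algebra_simps)
  \<comment> \<open>Each of \<open>p$1\<close> and \<open>q$2\<close> is 0 or \<open>r$3\<close>,
    and they differ by 1, so one vanishes and the other equals \<open>r$3\<close>.\<close>
  have cases: "p$1 = -1 \<and> q$2 = 0 \<and> r$3 = -1 \<or> p$1 = 0 \<and> q$2 = 1 \<and> r$3 = 1"
    using pr qr qp by auto
  then have r2: "r$2 = 0"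
    using r2 by auto
  \<comment> \<open>The shear makes \<open>f2'\<close> an eigenvector of right multiplication by
    \<open>e3\<close>, since \<open>q$2 = p$1 + 1\<close>. The translation makes the square of
    \<open>f3'\<close> proportional to \<open>f3'\<close>; the factor 1/2 serves both cases because
    \<open>r$3 = 1 + 2 * p$1\<close>.\<close>
  define f2' where "f2' = e2 + q$1 *\<^sub>R e1"
  define f3' where "f3' = e3 + (r$1 / 2) *\<^sub>R e1"
  have "connections_isomorphic g33 (conn a b c p q r)
      (conn 0 0 e1 (p$1 *\<^sub>R e1) (q$2 *\<^sub>R e2) (r$3 *\<^sub>R e3))"
  proof (rule frame_isomorphicI[OF flat, of e1 f2' f3'])
    show "frame e1 f2' f3'"
      by (simp add: frame_def f2'_def f3'_def basis_nth)
  qed (use cases in \<open>auto simp: conn_apply comb_def f2'_def f3'_def ab c z p2 r2 basis_nth vec_eq_iff forall_3\<close>)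
  then have "connections_isomorphic g33 nabla (conn 0 0 e1 (p$1 *\<^sub>R e1) (q$2 *\<^sub>R e2) (r$3 *\<^sub>R e3))"
    by (rule connections_isomorphic_trans[OF iso])
  then have "connections_isomorphic g33 nabla (connection_of H2_1) \<or>
      connections_isomorphic g33 nabla (connection_of H2_2)"
    using cases unfolding connection_of_eq_conn by auto
  then show ?thesis
    by (metis admissible.simps(12,13))
qed

section \<open>Normal forms when products on the plane vanish\<close>

text \<open>Replacing \<open>e3\<close> by \<open>e3 + w\<close> does not affect right
  multiplication on the plane, and \<open>nabla e3 w = nabla w e3 - w\<close> gives the new
  square.\<close>

lemma zero_plane_productI:
  assumes nabla: "flat_lie_algebra g33 nabla"
    and plane: "\<And>u v. u$3 = 0 \<Longrightarrow> v$3 = 0 \<Longrightarrow> nabla u v = 0"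
    and w: "w$3 = 0" and fr: "frame f1 f2 (e3 + w)"
    and "nabla f1 e3 = comb f1 f2 (e3 + w) p" "nabla f2 e3 = comb f1 f2 (e3 + w) q"
    and "nabla e3 e3 + 2 *\<^sub>R nabla w e3 - w = comb f1 f2 (e3 + w) r"
  shows "connections_isomorphic g33 nabla (conn 0 0 0 p q r)"
proof -
  have bil: "bilinear nabla"
    using nabla by (simp add: flat_lie_algebra_def)
  note bil' = bilinear_ladd[OF bil] bilinear_radd[OF bil]
  have "nabla w e3 - nabla e3 w = w"
    using nabla w by (simp add: flat_lie_algebra_def torsion_free_def g33_eq)
  then have "nabla e3 w = nabla w e3 - w"
    by (simp add: algebra_simps)
  then have "nabla (e3 + w) (e3 + w) = nabla e3 e3 + 2 *\<^sub>R nabla w e3 - w"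
    using w by (simp add: bil' plane scaleR_2)
  then show ?thesis
    using assms by (intro frame_isomorphicI[OF nabla fr]) (simp_all add: bil' frame_def comb_def)
qed

lemma classification_zero_plane_product:
  assumes nabla: "flat_lie_algebra g33 nabla"
    and plane: "\<And>u v. u$3 = 0 \<Longrightarrow> v$3 = 0 \<Longrightarrow> nabla u v = 0"
  shows "\<exists>p. admissible p \<and> connections_isomorphic g33 nabla (connection_of p)"
proof -
  have bil: "bilinear nabla"
    using nabla by (simp add: flat_lie_algebra_def)
  define D where "D v = nabla v e3" for v
  have linD: "linear D"
    unfolding D_def using bil by (simp add: bilinear_def)
  note D = linear_add[OF linD] linear_diff[OF linD] linear_scale[OF linD] linear_0[OF linD]
  have D3: "D v $ 3 = 0" if "v$3 = 0" for v
    unfolding D_def using that by (intro flat_no_character[OF nabla]) (simp_all add: plane)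
  define m where "m = nabla e3 e3 $ 3"
  define r where "r = nabla e3 e3 - m *\<^sub>R e3"
  have e33: "nabla e3 e3 = r + m *\<^sub>R e3" and r3: "r$3 = 0"
    by (simp_all add: r_def m_def)
  \<comment> \<open>Flatness at \<open>(v, e3)\<close> applied to \<open>e3\<close>.\<close>
  have DD: "D (D v) = m *\<^sub>R D v" if v: "v$3 = 0" for v
  proof -
    have "nabla v (nabla e3 e3) - nabla e3 (D v) - nabla (g33 v e3) e3 = 0"
      using nabla unfolding D_def flat_lie_algebra_def flat_def by blast
    moreover have "nabla (D v) e3 - nabla e3 (D v) = D v"
      using nabla D3[OF v] by (simp add: flat_lie_algebra_def torsion_free_def g33_eq)
    moreover have "nabla v (nabla e3 e3) = m *\<^sub>R D v"
      unfolding e33 by (simp add: bilinear_radd[OF bil] bilinear_rmul[OF bil] plane v r3 D_def)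
    ultimately show ?thesis
      using v by (simp add: g33_eq D_def algebra_simps)
  qed
  \<comment> \<open>Relative to \<open>e3 + w\<close>, the plane part of the square is
    \<open>r\<close> plus \<open>2 D w - (1 + m) w\<close>. On an eigenvector of \<open>D\<close>
    with eigenvalue \<open>m\<close> or 0 the added term has factor \<open>m - 1\<close> or
    \<open>-(1 + m)\<close>, so obstructions to removing \<open>r\<close> arise only at
    \<open>m = 1\<close> or \<open>m = -1\<close>.\<close>
  have iso: "connections_isomorphic g33 nabla (conn 0 0 0 p q s)"
    if "w$3 = 0" "frame f1 f2 (e3 + w)" "D f1 = comb f1 f2 (e3 + w) p" "D f2 = comb f1 f2 (e3 + w) q"
      "r + m *\<^sub>R e3 + 2 *\<^sub>R D w - w = comb f1 f2 (e3 + w) s" for w f1 f2 p q s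
  proof (rule zero_plane_productI[OF nabla plane that(1,2)])
    show "nabla e3 e3 + 2 *\<^sub>R nabla w e3 - w = comb f1 f2 (e3 + w) s"
      using that(5) by (simp only: e33 D_def)
  qed (use that(3,4) in \<open>simp_all only: D_def\<close>)
  have goalI: ?thesis if "admissible p" "connections_isomorphic g33 nabla n" "n = connection_of p" for p n
    using that by metis
  have complement: thesis if "r \<noteq> 0" "\<And>g. frame g r (e3 + 0) \<Longrightarrow> thesis" for thesis
    using frame_complement[OF r3 that(1), of "e3 + 0"] that(2) by (auto simp: basis_nth)
  have std: "frame e1 e2 (e3 + w)" if "w$3 = 0" for w
    using that by (simp add: frame_def basis_nth)
  consider (zero) "\<And>v. v$3 = 0 \<Longrightarrow> D v = 0"
    | (scalar) "m \<noteq> 0" "\<And>v. v$3 = 0 \<Longrightarrow> D v = m *\<^sub>R v"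
    | (nilpotent) v where "m = 0" "v$3 = 0" "D v \<noteq> 0"
    | (rank1) v u where "m \<noteq> 0" "v$3 = 0" "D v \<noteq> 0" "u$3 = 0" "D u \<noteq> m *\<^sub>R u"
    by blast
  then show ?thesis
  proof cases
    case zero
    show ?thesis
    proof (cases "m = -1")
      case False
      define w where "w = inverse (1 + m) *\<^sub>R r"
      have w3: "w$3 = 0" and rw: "r = (1 + m) *\<^sub>R w"
        using False by (simp_all add: w_def r3 add_eq_0_iff)
      have "connections_isomorphic g33 nabla (conn 0 0 0 0 0 (m *\<^sub>R e3))"
        by (rule iso[OF w3 std[OF w3]])
           (simp_all add: zero w3 comb_def basis_nth, simp add: rw vec_eq_iff algebra_simps)
      \<comment> \<open>The parameter 0 is excluded from \<open>H0_7\<close>, and that connection is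
        listed as \<open>H0_1 0\<close>.\<close>
      moreover have "conn 0 0 0 0 0 (m *\<^sub>R e3) = connection_of (if m = 0 then H0_1 m else H0_7 m)"
        unfolding connection_of_eq_conn by (auto simp: connection_of_eq_conn simp del: connection_of.simps)
      ultimately show ?thesis
        by (rule_tac goalI) auto
    next
      case m: True
      show ?thesis
      proof (cases "r = 0")
        case True
        have "connections_isomorphic g33 nabla (conn 0 0 0 0 0 ((-1) *\<^sub>R e3))"
          by (rule iso[of 0, OF _ std]) (simp_all add: zero comb_def basis_nth D True m)
        then show ?thesis
          by (rule goalI[of "H0_7 (-1)", rotated]) (simp_all only: connection_of_eq_conn, simp)
      next
        case False
        then obtain g where g: "frame g r (e3 + 0)"
          by (rule complement)
        then have "g$3 = 0"
          by (simp add: frame_def)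
        then have "connections_isomorphic g33 nabla (conn 0 0 0 0 0 (e1 - e3))"
          \<comment> \<open>The remaining \<open>r\<close> has to be the first frame vector; the
            sign of \<open>- g\<close> keeps the determinant of the given frame.\<close>
          by (intro iso[of 0 r "- g"])
             (use g in \<open>simp_all add: zero comb_def basis_nth D m r3 frame_def algebra_simps\<close>)
        then show ?thesis
          by (rule goalI[of H0_8, rotated]) (simp_all only: connection_of_eq_conn, simp)
      qed
    qed
  next
    case scalar
    show ?thesis
    proof (cases "m = 1")
      case False
      define w where "w = inverse (1 - m) *\<^sub>R r"
      have w3: "w$3 = 0" and rw: "r = (1 - m) *\<^sub>R w"
        using False by (simp_all add: w_def r3)
      have "connections_isomorphic g33 nabla (conn 0 0 0 (m *\<^sub>R e1) (m *\<^sub>R e2) (m *\<^sub>R e3))"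
        by (rule iso[OF w3 std[OF w3]])
           (simp_all add: scalar w3 comb_def basis_nth, simp add: rw vec_eq_iff algebra_simps)
      then show ?thesis
        by (rule goalI[of "H0_1 m", rotated]) (simp_all only: connection_of_eq_conn, simp)
    next
      case m: True
      show ?thesis
      proof (cases "r = 0")
        case True
        have "connections_isomorphic g33 nabla (conn 0 0 0 (1 *\<^sub>R e1) (1 *\<^sub>R e2) (1 *\<^sub>R e3))"
          by (rule iso[of 0, OF _ std]) (simp_all add: scalar comb_def basis_nth D True m)
        then show ?thesis
          by (rule goalI[of "H0_1 1", rotated]) (simp_all only: connection_of_eq_conn, simp)
      next
        case False
        then obtain g where g: "frame g r (e3 + 0)"
          by (rule complement)
        then have "g$3 = 0"
          by (simp add: frame_def)
        then have "connections_isomorphic g33 nabla (conn 0 0 0 e1 e2 (e2 + e3))"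
          by (intro iso[of 0 g r]) (use g in \<open>simp_all add: scalar comb_def basis_nth D m r3\<close>)
        then show ?thesis
          by (rule goalI[of H0_2, rotated]) (simp_all only: connection_of_eq_conn, simp)
      qed
    qed
  next
    case nilpotent
    have DD0: "D (D x) = 0" if "x$3 = 0" for x
      using DD[OF that] nilpotent(1) by simp
    \<comment> \<open>Since \<open>D\<close> squares to zero on the plane, \<open>1 + 2 D\<close> is
      the inverse of \<open>1 - 2 D\<close>.\<close>
    define w where "w = r + 2 *\<^sub>R D r"
    have w3: "w$3 = 0"
      by (simp add: w_def r3 D3)
    have "D w = D r"
      by (simp add: w_def D DD0 r3)
    then have eq: "r + m *\<^sub>R e3 + 2 *\<^sub>R D w - w = 0"
      by (simp add: w_def nilpotent(1))
    have fr: "frame v (D v) (e3 + w)"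
    proof (rule frameI)
      show "D v \<noteq> k *\<^sub>R v" for k
      proof
        assume k: "D v = k *\<^sub>R v"
        have "D (D v) = k *\<^sub>R D v"
          by (subst k, simp only: D)
        then have "k = 0"
          using DD0[OF nilpotent(2)] nilpotent(3) by (metis scaleR_eq_0_iff)
        then show False
          using k nilpotent(3) by simp
      qed
    qed (use nilpotent w3 D in \<open>auto simp: D3 basis_nth\<close>)
    have "connections_isomorphic g33 nabla (conn 0 0 0 0 e1 0)"
      by (rule iso[OF w3 frame_swap[OF fr]])
         (simp_all only: eq DD0[OF nilpotent(2)], simp_all add: comb_def basis_nth)
    then show ?thesis
      by (rule goalI[of H0_6, rotated]) (simp_all only: connection_of_eq_conn, simp)
  next
    case rank1
    \<comment> \<open>By \<open>DD\<close>, these are eigenvectors of \<open>D\<close> with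
      eigenvalues \<open>m\<close> and 0.\<close>
    define g1 g2 where "g1 = D v" and "g2 = D u - m *\<^sub>R u"
    have g3: "g1$3 = 0" "g2$3 = 0" and Dg: "D g1 = m *\<^sub>R g1" "D g2 = 0"
      and g0: "g1 \<noteq> 0" "g2 \<noteq> 0"
      using rank1 by (simp_all add: g1_def g2_def D3 D DD)
    have fr: "frame (s *\<^sub>R g1) (t *\<^sub>R g2) (e3 + w)" if "w$3 = 0" "s \<noteq> 0" "t \<noteq> 0" for s t w
    proof -
      have "frame g1 g2 (e3 + w)"
      proof (rule frameI)
        show "g2 \<noteq> k *\<^sub>R g1" for k
        proof
          assume k: "g2 = k *\<^sub>R g1"
          then have "D g2 = k *\<^sub>R m *\<^sub>R g1"
            by (simp add: D Dg)
          then show False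
            using Dg g0 rank1(1) k by auto
        qed
      qed (use g3 g0 that in \<open>auto simp: basis_nth\<close>)
      moreover have "s * g1$1 * (t * g2$2) - s * g1$2 * (t * g2$1) = s * t * (g1$1 * g2$2 - g1$2 * g2$1)"
        by (simp add: algebra_simps)
      ultimately show ?thesis
        using that by (simp add: frame_def)
    qed
    have "frame g1 g2 (e3 + 0)"
      using fr[of 0 1 1] by simp
    from comb_coords[OF this, of r] obtain s t where st: "r = s *\<^sub>R g1 + t *\<^sub>R g2"
      by (simp add: comb_def coords_nth_3 r3) metis
    \<comment> \<open>The translation cancels both components of \<open>r\<close> except at
      \<open>m = 1\<close> or \<open>m = -1\<close>, where the affected component cannot be changed
      and the default 0 is taken.\<close>
    define x y where "x = (if m = 1 then 0 else s / (1 - m))" and "y = (if m = -1 then 0 else t / (1 + m))"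
    define w where "w = x *\<^sub>R g1 + y *\<^sub>R g2"
    define s' t' where "s' = s + (m - 1) * x" and "t' = t - (1 + m) * y"
    have w3: "w$3 = 0"
      by (simp add: w_def g3)
    have eq: "r + m *\<^sub>R e3 + 2 *\<^sub>R D w - w = s' *\<^sub>R g1 + t' *\<^sub>R g2 + m *\<^sub>R (e3 + w)"
      by (simp add: st w_def s'_def t'_def D Dg vec_eq_iff algebra_simps)
    \<comment> \<open>Rescaling the eigenvectors absorbs what is left of \<open>r\<close>, so
      \<open>k\<close> and \<open>l\<close> can be taken in 0 and 1. They are never both 1, as
      \<open>m\<close> cannot be 1 and -1 at once.\<close>
    have key: "connections_isomorphic g33 nabla (conn 0 0 0 (m *\<^sub>R e1) 0 (k *\<^sub>R e1 + l *\<^sub>R e2 + m *\<^sub>R e3))"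
      if "a \<noteq> 0" "b \<noteq> 0" "s' = k * a" "t' = l * b" for a b k l
      by (rule iso[OF w3 fr[OF w3 that(1,2)]]) (simp_all add: comb_def basis_nth D Dg eq that)
    have s': "s' = 0 \<or> m = 1"
      by (simp add: s'_def x_def divide_simps) (simp add: algebra_simps)
    have t': "t' = 0 \<or> m = -1"
      by (simp add: t'_def y_def)
    consider "s' = 0" "t' = 0" | "s' \<noteq> 0" "t' = 0" "m = 1" | "s' = 0" "t' \<noteq> 0" "m = -1"
      using s' t' by force
    then show ?thesis
    proof cases
      case 1
      then have "connections_isomorphic g33 nabla (conn 0 0 0 (m *\<^sub>R e1) 0 (m *\<^sub>R e3))"
        using key[of 1 1 0 0] by simp
      then show ?thesis
        by (rule goalI[of "H0_3 m", rotated]) (simp_all only: connection_of_eq_conn, simp add: rank1)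
    next
      case 2
      then have "connections_isomorphic g33 nabla (conn 0 0 0 e1 0 (e1 + e3))"
        using key[of s' 1 1 0] by simp
      then show ?thesis
        by (rule goalI[of H0_5, rotated]) (simp_all only: connection_of_eq_conn, simp)
    next
      case 3
      then have "connections_isomorphic g33 nabla (conn 0 0 0 (-e1) 0 (e2 - e3))"
        using key[of 1 t' 0 1] by simp
      then show ?thesis
        by (rule goalI[of H0_4, rotated]) (simp_all only: connection_of_eq_conn, simp)
    qed
  qed
qed

lemma classification:
  assumes nabla: "flat_lie_algebra g33 nabla"
  shows "\<exists>p. admissible p \<and> connections_isomorphic g33 nabla (connection_of p)"
proof (cases "\<forall>u v. u$3 = 0 \<longrightarrow> v$3 = 0 \<longrightarrow> nabla u v $ 3 = 0")
  case False
  moreover have "linear (\<lambda>x::real^3. x $ 3)"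
    by (simp add: linear_iff)
  ultimately obtain v where "v$3 = 0" "nabla v v $ 3 \<noteq> 0"
    using ex_nonisotropic[OF nabla, of "\<lambda>x. x $ 3"] by blast
  then show ?thesis
    by (rule classification_transversal[OF nabla])
next
  case plane: True
  show ?thesis
  proof (cases "\<forall>u v. u$3 = 0 \<longrightarrow> v$3 = 0 \<longrightarrow> nabla u v = 0")
    case False
    then obtain v where "v$3 = 0" "nabla v v \<noteq> 0"
      using ex_nonisotropic[OF nabla, of "\<lambda>x. x"] linear_ident by blast
    then show ?thesis
      using plane by (intro classification_nonzero_plane_product[OF nabla]) auto
  next
    case True
    then show ?thesis
      by (intro classification_zero_plane_product[OF nabla]) blast
  qed
qed

subsection \<open>Invariants\<close>

definition signature where
  "signature nabla =
    ({(nabla x x) $ 3 | x. x $ 3 = 1},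
     \<exists>x c. x $ 3 = 1 \<and> nabla x x = c *\<^sub>R x,
     \<exists>v. v \<noteq> 0 \<and> v $ 3 = 0 \<and> (\<forall>y. nabla v y = 0),
     \<forall>v y. v $ 3 = 0 \<longrightarrow> nabla v y = 0,
     \<forall>u v. u $ 3 = 0 \<longrightarrow> v $ 3 = 0 \<longrightarrow> nabla u v = 0)"
  for nabla :: "real^3 \<Rightarrow> real^3 \<Rightarrow> real^3"

text \<open>All components are built from products, linear structure and third coordinates, which
  \<open>\<Psi>\<close> respects; every quantifier is reindexed along the surjection
  \<open>\<Psi>\<close>.\<close>

lemma signature_eqI:
  assumes "connections_isomorphic g33 nabla1 nabla2"
  shows "signature nabla1 = signature nabla2"
proof -
  obtain \<Psi> where \<Psi>: "lie_automorphism g33 \<Psi>"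
      and hom: "\<And>X Y. \<Psi> (nabla1 X Y) = nabla2 (\<Psi> X) (\<Psi> Y)"
    using assms by (elim connections_isomorphicE) blast
  have n3: "\<Psi> X $ 3 = X $ 3" for X
    using lie_automorphism_g33_nth_3[OF \<Psi>] .
  have bij: "bij \<Psi>" and lin: "linear \<Psi>"
    using \<Psi> by (auto simp: lie_automorphism_def)
  have zero: "\<Psi> x = 0 \<longleftrightarrow> x = 0" for x
    using bij lin by (metis bij_is_inj linear_0 linear_injective_0)
  have eq: "\<Psi> x = \<Psi> y \<longleftrightarrow> x = y" for x y
    using bij by (simp add: bij_is_inj inj_eq)
  have ex: "(\<exists>x. P x) \<longleftrightarrow> (\<exists>x. P (\<Psi> x))" and all: "(\<forall>x. P x) \<longleftrightarrow> (\<forall>x. P (\<Psi> x))" for P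
    using bij[THEN bij_is_surj] by (auto simp: surj_def) metis+
  have 1: "{(nabla2 x x) $ 3 | x. x $ 3 = 1} = {(nabla1 x x) $ 3 | x. x $ 3 = 1}"
  proof -
    have "(\<exists>x. t = (nabla2 x x) $ 3 \<and> x $ 3 = 1) \<longleftrightarrow> (\<exists>x. t = (nabla1 x x) $ 3 \<and> x $ 3 = 1)" for t
      by (subst ex) (simp add: hom[symmetric] n3)
    then show ?thesis
      by auto
  qed
  have 2: "(\<exists>x c. x $ 3 = 1 \<and> nabla2 x x = c *\<^sub>R x) \<longleftrightarrow> (\<exists>x c. x $ 3 = 1 \<and> nabla1 x x = c *\<^sub>R x)"
    by (subst ex) (simp add: hom[symmetric] n3 eq linear_scale[OF lin, symmetric])
  have ker: "(\<forall>y. nabla2 (\<Psi> v) y = 0) \<longleftrightarrow> (\<forall>y. nabla1 v y = 0)" for v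
    by (subst all) (simp add: hom[symmetric] zero)
  have 3: "(\<exists>v. v \<noteq> 0 \<and> v $ 3 = 0 \<and> (\<forall>y. nabla2 v y = 0)) \<longleftrightarrow>
      (\<exists>v. v \<noteq> 0 \<and> v $ 3 = 0 \<and> (\<forall>y. nabla1 v y = 0))"
    by (subst ex) (simp add: n3 zero ker)
  have "(\<forall>v. v $ 3 = 0 \<longrightarrow> (\<forall>y. nabla2 v y = 0)) \<longleftrightarrow> (\<forall>v. v $ 3 = 0 \<longrightarrow> (\<forall>y. nabla1 v y = 0))"
    by (subst all) (simp add: n3 ker)
  then have 4: "(\<forall>v y. v $ 3 = 0 \<longrightarrow> nabla2 v y = 0) \<longleftrightarrow> (\<forall>v y. v $ 3 = 0 \<longrightarrow> nabla1 v y = 0)"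
    by blast
  have "(\<forall>v. v $ 3 = 0 \<longrightarrow> nabla2 (\<Psi> u) v = 0) \<longleftrightarrow> (\<forall>v. v $ 3 = 0 \<longrightarrow> nabla1 u v = 0)" for u
    by (subst all) (simp add: n3 hom[symmetric] zero)
  then have "(\<forall>u. u $ 3 = 0 \<longrightarrow> (\<forall>v. v $ 3 = 0 \<longrightarrow> nabla2 u v = 0)) \<longleftrightarrow>
      (\<forall>u. u $ 3 = 0 \<longrightarrow> (\<forall>v. v $ 3 = 0 \<longrightarrow> nabla1 u v = 0))"
    by (subst all) (simp add: n3)
  then have 5: "(\<forall>u v. u $ 3 = 0 \<longrightarrow> v $ 3 = 0 \<longrightarrow> nabla2 u v = 0) \<longleftrightarrow>
      (\<forall>u v. u $ 3 = 0 \<longrightarrow> v $ 3 = 0 \<longrightarrow> nabla1 u v = 0)"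
    by blast
  show ?thesis
    unfolding signature_def 1 2 3 4 5 ..
qed

section \<open>Signatures of the listed entries\<close>

lemma ex_vec3: "(\<exists>x::real^3. P x) \<longleftrightarrow> (\<exists>a b c. P (vector [a, b, c]))"
proof
  assume "\<exists>x. P x"
  then obtain x where "P x" ..
  moreover have "x = vector [x$1, x$2, x$3]"
    by (rule vec3_eqI) simp_all
  ultimately show "\<exists>a b c. P (vector [a, b, c])"
    by metis
qed auto

text \<open>The square of \<open>vector [x, y, 1]\<close> under the table, as a polynomial in
  \<open>x\<close> and \<open>y\<close>.\<close>

definition plane_square where
  "plane_square a b p b' c q p' q' r x y =
    x\<^sup>2 *\<^sub>R a + (x * y) *\<^sub>R (b + b') + y\<^sup>2 *\<^sub>R c + x *\<^sub>R (p + p') + y *\<^sub>R (q + q') + r"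
  for a b p b' c q p' q' r :: "real^3"

lemma of_table_square:
  "of_table a b p b' c q p' q' r (vector [x, y, 1]) (vector [x, y, 1]) =
    plane_square a b p b' c q p' q' r x y"
  by (simp add: of_table_def plane_square_def power2_eq_square algebra_simps)

lemma of_table_basis:
  fixes a b p b' c q p' q' r :: "real^3"
  defines "nabla \<equiv> of_table a b p b' c q p' q' r"
  shows "nabla e1 e1 = a" "nabla e1 e2 = b" "nabla e1 e3 = p"
    "nabla e2 e1 = b'" "nabla e2 e2 = c" "nabla e2 e3 = q"
    "nabla e3 e1 = p'" "nabla e3 e2 = q'" "nabla e3 e3 = r"
  by (simp_all add: nabla_def of_table_def axis_def)

lemma plane_left_kernel_of_table:
  "(\<forall>z. of_table a b p b' c q p' q' r (vector [x, y, 0]) z = 0) \<longleftrightarrow>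
    x *\<^sub>R a + y *\<^sub>R b' = 0 \<and> x *\<^sub>R b + y *\<^sub>R c = 0 \<and> x *\<^sub>R p + y *\<^sub>R q = 0" (is "?L \<longleftrightarrow> ?R")
proof
  assume ?L
  then show ?R
    by (auto simp: of_table_def axis_def dest: spec[of _ e1] spec[of _ e2] spec[of _ e3])
next
  assume ?R
  moreover have "of_table a b p b' c q p' q' r (vector [x, y, 0]) z =
      z$1 *\<^sub>R (x *\<^sub>R a + y *\<^sub>R b') + z$2 *\<^sub>R (x *\<^sub>R b + y *\<^sub>R c) + z$3 *\<^sub>R (x *\<^sub>R p + y *\<^sub>R q)" for z
    by (simp add: of_table_def algebra_simps)
  ultimately show ?L
    by simp
qed

lemma ex_vec3_plane: "(\<exists>v::real^3. v $ 3 = t \<and> P v) \<longleftrightarrow> (\<exists>x y. P (vector [x, y, t]))"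
  by (subst ex_vec3) simp

lemma signature_of_table:
  "signature (of_table a b p b' c q p' q' r) =
    ({plane_square a b p b' c q p' q' r x y $ 3 | x y. True},
     \<exists>x y s. plane_square a b p b' c q p' q' r x y = s *\<^sub>R vector [x, y, 1],
     \<exists>x y. (x \<noteq> 0 \<or> y \<noteq> 0) \<and>
       x *\<^sub>R a + y *\<^sub>R b' = 0 \<and> x *\<^sub>R b + y *\<^sub>R c = 0 \<and> x *\<^sub>R p + y *\<^sub>R q = 0,
     a = 0 \<and> b = 0 \<and> p = 0 \<and> b' = 0 \<and> c = 0 \<and> q = 0,
     a = 0 \<and> b = 0 \<and> b' = 0 \<and> c = 0)"
proof -
  let ?n = "of_table a b p b' c q p' q' r"
  have 1: "{?n x x $ 3 | x. x $ 3 = 1} = {plane_square a b p b' c q p' q' r x y $ 3 | x y. True}"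
    proof -
    have "(\<exists>x. t = ?n x x $ 3 \<and> x $ 3 = 1) \<longleftrightarrow> (\<exists>x y. t = plane_square a b p b' c q p' q' r x y $ 3)" for t
      using ex_vec3_plane[of 1 "\<lambda>x. t = ?n x x $ 3"] by (auto simp: of_table_square conj_commute)
    then show ?thesis
      by auto
  qed
  have 2: "(\<exists>x s. x $ 3 = 1 \<and> ?n x x = s *\<^sub>R x) \<longleftrightarrow>
      (\<exists>x y s. plane_square a b p b' c q p' q' r x y = s *\<^sub>R vector [x, y, 1])"
    using ex_vec3_plane[of 1 "\<lambda>x. \<exists>s. ?n x x = s *\<^sub>R x"] by (auto simp: of_table_square)
  have 3: "(\<exists>v. v \<noteq> 0 \<and> v $ 3 = 0 \<and> (\<forall>z. ?n v z = 0)) \<longleftrightarrow>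
     (\<exists>x y. (x \<noteq> 0 \<or> y \<noteq> 0) \<and>
       x *\<^sub>R a + y *\<^sub>R b' = 0 \<and> x *\<^sub>R b + y *\<^sub>R c = 0 \<and> x *\<^sub>R p + y *\<^sub>R q = 0)"
  proof -
    have "vector [x, y, 0] \<noteq> (0::real^3) \<longleftrightarrow> x \<noteq> 0 \<or> y \<noteq> 0" for x y
      by (simp add: vec_eq_iff[where 'b=3] forall_3)
    then show ?thesis
      using ex_vec3_plane[of 0 "\<lambda>v. v \<noteq> 0 \<and> (\<forall>z. ?n v z = 0)"]
      unfolding plane_left_kernel_of_table by (simp only: conj_left_commute)
  qed
  have 4: "(\<forall>v z. v $ 3 = 0 \<longrightarrow> ?n v z = 0) \<longleftrightarrow>
      a = 0 \<and> b = 0 \<and> p = 0 \<and> b' = 0 \<and> c = 0 \<and> q = 0" (is "?L \<longleftrightarrow> ?R")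
  proof
    assume L: ?L
    have "?n e1 z = 0" "?n e2 z = 0" for z
      by (auto intro!: L[rule_format] simp: axis_def)
    then show ?R
      by (metis of_table_basis)
  qed (simp add: of_table_def)
  have 5: "(\<forall>u v. u $ 3 = 0 \<longrightarrow> v $ 3 = 0 \<longrightarrow> ?n u v = 0) \<longleftrightarrow>
      a = 0 \<and> b = 0 \<and> b' = 0 \<and> c = 0" (is "?L \<longleftrightarrow> ?R")
  proof
    assume L: ?L
    have "?n e1 e1 = 0" "?n e1 e2 = 0" "?n e2 e1 = 0" "?n e2 e2 = 0"
      by (auto intro!: L[rule_format] simp: axis_def)
    then show ?R
      by (simp add: of_table_basis)
  qed (simp add: of_table_def)
  show ?thesis
    unfolding signature_def 1 2 3 4 5 ..
qed

text \<open>When a square leaves the plane, the set is the range of a quadratic form shifted by -2: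
  a half-line if the form is semidefinite, the whole line if it is indefinite. \<open>H0_10\<close>
  and the mixed-sign \<open>H0_11\<close> therefore agree. The \<open>else\<close> branches read a
  sign other than 1 as -1, as for admissible entries.\<close>

fun entry_signature :: "entry \<Rightarrow> real set \<times> bool \<times> bool \<times> bool \<times> bool" where
  "entry_signature (H0_1 lam) = ({lam}, True, lam = 0, lam = 0, True)"
| "entry_signature H0_2 = ({1}, False, False, False, True)"
| "entry_signature (H0_3 lam) = ({lam}, True, True, False, True)"
| "entry_signature H0_4 = ({-1}, False, True, False, True)"
| "entry_signature H0_5 = ({1}, False, True, False, True)"
| "entry_signature H0_6 = ({0}, True, True, False, True)"
| "entry_signature (H0_7 lam) = ({lam}, True, True, True, True)"
| "entry_signature H0_8 = ({-1}, False, True, True, True)"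
| "entry_signature (H0_9 \<epsilon>) = (if \<epsilon> = 1 then {-2..} else {..-2}, True, True, False, False)"
| "entry_signature H0_10 = (UNIV, True, False, False, False)"
| "entry_signature (H0_11 \<epsilon> \<eta>) =
    (if \<epsilon> \<noteq> \<eta> then UNIV else if \<epsilon> = 1 then {-2..} else {..-2}, True, False, False, False)"
| "entry_signature H2_1 = ({-1}, True, False, False, False)"
| "entry_signature H2_2 = ({1}, True, True, False, False)"

lemma same_class_if_entry_signature_eq:
  assumes "admissible p" "admissible q" "entry_signature p = entry_signature q"
  shows "same_class p q"
proof -
  have inf: "infinite {-2::real..}" "infinite {..-2::real}" "infinite (UNIV::real set)"
    by (simp_all add: infinite_Ici infinite_Iic infinite_UNIV_char_0)
  have fin: "{-2::real..} \<noteq> {a}" "{..-2::real} \<noteq> {a}" "UNIV \<noteq> {a::real}" for a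
    using inf by (metis finite.emptyI finite_insert)+
  \<comment> \<open>Witnesses separating the two half-lines from each other and from the
    line.\<close>
  have "-3 \<notin> {-2::real..}" "-1 \<notin> {..-2::real}" "-1 \<in> {-2::real..}"
    by auto
  then have ne: "{-2::real..} \<noteq> {..-2}" "{-2..} \<noteq> (UNIV::real set)" "{..-2} \<noteq> (UNIV::real set)"
    by (metis UNIV_I)+
  show ?thesis
    using assms
    by (cases p; cases q; simp only: admissible.simps entry_signature.simps prod.inject simp_thms
        fin ne fin[symmetric] ne[symmetric] split: if_splits) (auto simp: same_class_def)
qed

lemma signature_connection_of:
  assumes "admissible p"
  shows "signature (connection_of p) = entry_signature p"
proof -
  \<comment> \<open>Goals left by the proportionality and left-kernel components.\<close>
  have ex: "\<exists>x::real. x \<noteq> 0" "\<exists>x::real. - x = l * x" "\<exists>x y::real. y\<^sup>2 = 2 * x"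
      "\<exists>x y. - x = F x y * x \<and> - y = F x y * y" for l :: real and F :: "real \<Rightarrow> real \<Rightarrow> real"
    by (rule exI[of _ 1], simp) (rule exI[of _ 0], auto intro!: exI[of _ 0])+
  have sq: "(\<exists>y. u = y\<^sup>2 - 2) \<longleftrightarrow> -2 \<le> u" "(\<exists>y. u = - y\<^sup>2 - 2) \<longleftrightarrow> u \<le> -2" for u :: real
  proof -
    show "(\<exists>y. u = y\<^sup>2 - 2) \<longleftrightarrow> -2 \<le> u"
      by (auto intro: exI[of _ "sqrt (u + 2)"])
    show "(\<exists>y. u = - y\<^sup>2 - 2) \<longleftrightarrow> u \<le> -2"
      by (auto intro: exI[of _ "sqrt (-2 - u)"])
  qed
  have sq_sum: "(\<exists>x y. u = x\<^sup>2 + y\<^sup>2 - 2) \<longleftrightarrow> -2 \<le> u" "(\<exists>x y. u = - x\<^sup>2 - y\<^sup>2 - 2) \<longleftrightarrow> u \<le> -2"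
    for u :: real
  proof -
    show "(\<exists>x y. u = x\<^sup>2 + y\<^sup>2 - 2) \<longleftrightarrow> -2 \<le> u"
      by (auto intro: exI[of _ "sqrt (u + 2)"] exI[of _ 0])
    show "(\<exists>x y. u = - x\<^sup>2 - y\<^sup>2 - 2) \<longleftrightarrow> u \<le> -2"
      by (auto intro: exI[of _ "sqrt (-2 - u)"] exI[of _ 0])
  qed
  have hyp: "\<exists>x y. u = x\<^sup>2 - y\<^sup>2 - 2" "\<exists>x y. u = y\<^sup>2 - x\<^sup>2 - 2" "\<exists>x y. u = x * y * 2 - 2" for u :: real
  proof -
    \<comment> \<open>A difference of squares with factors 1 and \<open>u + 2\<close>.\<close>
    have "u = ((u + 3) / 2)\<^sup>2 - ((u + 1) / 2)\<^sup>2 - 2"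
      by (simp add: power2_eq_square field_simps)
    then show "\<exists>x y. u = x\<^sup>2 - y\<^sup>2 - 2" "\<exists>x y. u = y\<^sup>2 - x\<^sup>2 - 2"
      by blast+
    have "u = 1 * ((u + 2) / 2) * 2 - 2"
      by (simp add: add_divide_distrib)
    then show "\<exists>x y. u = x * y * 2 - 2"
      by blast
  qed
  show ?thesis
    using assms
    by (cases p; simp add: signature_of_table plane_square_def axis_def vec_eq_iff forall_3)
       (auto simp: ex sq sq_sum hyp)
qed

section \<open>Uniqueness up to the coinciding entries\<close>

lemma isomorphic_if_same_class:
  assumes "same_class p q"
  shows "connections_isomorphic g33 (connection_of p) (connection_of q)"
proof (cases "p = q")
  case True
  then show ?thesis
    by (simp only: connections_isomorphic_refl)
next
  case False
  have *: "connections_isomorphic g33 (connection_of H0_10) (connection_of x)"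
    if "x \<in> {H0_10, H0_11 1 (-1), H0_11 (-1) 1}" for x
    using that H0_10_isomorphic_H0_11 connections_isomorphic_refl by (metis empty_iff insert_iff)
  have "p \<in> {H0_10, H0_11 1 (-1), H0_11 (-1) 1}" "q \<in> {H0_10, H0_11 1 (-1), H0_11 (-1) 1}"
    using assms False by (auto simp: same_class_def)
  then show ?thesis
    using * connections_isomorphic_sym connections_isomorphic_trans by metis
qed

theorem proposition6:
  fixes nabla :: "real^3 \<Rightarrow> real^3 \<Rightarrow> real^3"
  assumes "flat_lie_algebra g33 nabla"
  shows "\<exists>p. admissible p \<and> connections_isomorphic g33 nabla (connection_of p) \<and>
    (\<forall>q. admissible q \<longrightarrow>
      (connections_isomorphic g33 nabla (connection_of q) \<longleftrightarrow> same_class p q))"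
proof -
  obtain p where p: "admissible p" "connections_isomorphic g33 nabla (connection_of p)"
    using classification[OF assms] by blast
  have "connections_isomorphic g33 nabla (connection_of q) \<longleftrightarrow> same_class p q" if "admissible q" for q
  proof
    assume "connections_isomorphic g33 nabla (connection_of q)"
    then have "signature (connection_of p) = signature (connection_of q)"
      using p(2) signature_eqI by metis
    then show "same_class p q"
      using p(1) that by (intro same_class_if_entry_signature_eq) (simp_all add: signature_connection_of)
  next
    assume "same_class p q"
    then show "connections_isomorphic g33 nabla (connection_of q)"
      using connections_isomorphic_trans[OF p(2)] isomorphic_if_same_class by blast
  qed
  then show ?thesis
    using p by blast
qed

end
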